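(* Let $\mathcal{L}: c_1x_1+\dots+c_kx_k=0$ with $k\ge3$, $c_1,\dots,c_k\in\mathbb{Z}\setminus\{0\}$, $c_1+\dots+c_k\ne0$, and suppose there exists a non-empty $S\subseteq[k]$ with $\sum_{s\in S}c_s=0$. Then $d(\mathcal{L},\varepsilon)=\varepsilon^{\Theta(1)}$; that is, there exist constants $C_1,C_2>0$ depending only on $\mathcal{L}$ such that $\varepsilon^{C_1}\le d(\mathcal{L},\varepsilon)\le\varepsilon^{C_2}$ for all sufficiently small $\varepsilon>0$.
   Context: For a prime $p$, a set $A\subseteq\mathbb{F}_p$ is solution-free for $\mathcal{L}$ if there is no $k$-tuple of pairwise distinct elements $a_1,\dots,a_k\in A$ with $\sum_i c_ia_i=0$ in $\mathbb{F}_p$. The Cayley graph $\mathrm{Cay}_{\mathbb{F}_p}(A)$ is the digraph on $\mathbb{F}_p$ with an arc $\vec{uv}$ iff $v-u\in A$; $\alpha$ of a digraph is the independence number of its underlying undirected graph. $D(\mathcal{L},\varepsilon,p)$ is the maximum size of a solution-free set $A$ of $\mathcal{L}$ in $\mathbb{F}_p$ with $\alpha(\mathrm{Cay}_{\mathbb{F}_p}(A))\le\varepsilon p$, and $d(\mathcal{L},\varepsilon):=\limsup_{p\to\infty,\ p\text{ prime}} D(\mathcal{L},\varepsilon,p)/p$. *)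

theory Defs
  imports
    "HOL-Analysis.Analysis"
    "HOL-Number_Theory.Number_Theory"
    "Graph_Theory.Pair_Digraph"
begin

text \<open>
  The field with \<open>p\<close> elements is represented by \<open>carrier (residue_ring (int p))\<close>, that is,
  by the residues \<open>0, \<dots>, p - 1\<close>, with arithmetic modulo \<open>p\<close>. The equation
  \<open>c 1 * x 1 + \<dots> + c k * x k = 0\<close> is represented by \<open>k\<close> and \<open>c\<close>; only the values of \<open>c\<close>
  on \<open>{1..k}\<close> are used.
\<close>

definition solution_free :: "nat \<Rightarrow> (nat \<Rightarrow> int) \<Rightarrow> nat \<Rightarrow> int set \<Rightarrow> bool" where
  "solution_free k c p A \<longleftrightarrow>
     \<not> (\<exists>a. inj_on a {1..k} \<and> a ` {1..k} \<subseteq> A \<and> [(\<Sum>i=1..k. c i * a i) = 0] (mod int p))"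

definition cayley_digraph :: "nat \<Rightarrow> int set \<Rightarrow> int pair_pre_digraph" where
  "cayley_digraph p A =
     \<lparr> pverts = carrier (residue_ring (int p)),
       parcs = {(u, v). u \<in> carrier (residue_ring (int p)) \<and> v \<in> carrier (residue_ring (int p))
                  \<and> (v - u) mod int p \<in> A} \<rparr>"

text \<open>
  Independence refers to the underlying simple undirected graph: the direction of arcs is
  irrelevant, and so are loops. The latter matters for Cayley digraphs, which have a loop at
  every vertex as soon as the connection set contains \<open>0\<close>.
\<close>

definition independent_set :: "'a pair_pre_digraph \<Rightarrow> 'a set \<Rightarrow> bool" where
  "independent_set G I \<longleftrightarrow>
     I \<subseteq> pverts G \<and>
     (\<forall>u\<in>I. \<forall>v\<in>I. u \<noteq> v \<longrightarrow> (u, v) \<notin> parcs G \<and> (v, u) \<notin> parcs G)"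

definition independence_number :: "'a pair_pre_digraph \<Rightarrow> nat" where
  "independence_number G = Max {card I |I. independent_set G I}"

text \<open>
  For very small \<open>p\<close> there may be no admissible set at all (for instance if \<open>\<epsilon> * p < 1\<close>);
  the inserted \<open>0\<close> fixes the maximum to be \<open>0\<close> in that case and has no effect otherwise.
\<close>

definition max_solution_free :: "nat \<Rightarrow> (nat \<Rightarrow> int) \<Rightarrow> real \<Rightarrow> nat \<Rightarrow> nat" where
  "max_solution_free k c \<epsilon> p =
     Max (insert 0 {card A |A. A \<subseteq> carrier (residue_ring (int p)) \<and> solution_free k c p A \<and>
                      real (independence_number (cayley_digraph p A)) \<le> \<epsilon> * real p})"

definition limsup_density :: "nat \<Rightarrow> (nat \<Rightarrow> int) \<Rightarrow> real \<Rightarrow> ereal" where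
  "limsup_density k c \<epsilon> =
     Limsup (inf at_top (principal {p. prime p}))
       (\<lambda>p. ereal (real (max_solution_free k c \<epsilon> p) / real p))"

end

theory Submission
  imports Defs
begin

text \<open>
  Upper bound. Let \<open>S\<close> be a zero-sum set of indices, \<open>s \<in> S\<close>, and let \<open>A\<close> be solution-free with
  \<open>\<alpha>(Cay(A)) \<le> \<epsilon> p\<close>. By a Roth-type theorem for translation-invariant equations, all but \<open>\<epsilon> p\<close>
  elements \<open>u\<close> of \<open>A\<close> satisfy \<open>c s * u + (\<Sum>i\<in>S - {s}. c i * x i) = 0\<close> for some distinct
  \<open>x i \<in> A\<close>; no quantitative dependence is needed here, because \<open>p\<close> tends to infinity before
  \<open>\<epsilon>\<close> tends to \<open>0\<close>. The bound on \<open>\<alpha>\<close>, applied to dilates of \<open>A\<close>, shows that from all but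
  \<open>O(\<epsilon> p)\<close> elements \<open>u\<close> of \<open>A\<close> there is a path inside \<open>A\<close> whose steps are
  \<open>- (c t / c s) * z t\<close> with \<open>z t \<in> A\<close>, one for each index \<open>t \<notin> S\<close>. Taking the end of that path
  as \<open>x s\<close> gives a solution, so \<open>|A| = O(\<epsilon> p)\<close>.

  Lower bound. Let \<open>q\<close> not divide \<open>\<Sum>i. c i\<close>, map the residues to a torus of dimension about
  \<open>log (1 / \<epsilon>)\<close>, and let \<open>A\<close> be the set of residues most of whose coordinates are close to
  \<open>1 / q\<close>. In a solution inside \<open>A\<close> some coordinate would be close to \<open>1 / q\<close> for all
  variables at once, which is impossible. By concentration of measure in \<open>{0..<q}\<^sup>d\<close>, any set of
  more than \<open>\<epsilon> p\<close> residues has two elements that differ by about \<open>1 / q\<close> in most coordinates.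
\<close>

section \<open>Roth's theorem for translation-invariant equations\<close>

text \<open>Roth's theorem is proved over the integers: a solution there among the residues
  \<open>0, ..., p - 1\<close> is also a solution modulo \<open>p\<close>. Its proof takes a
  solution-free set of maximal size in a long interval. Such a set cannot be noticeably denser on
  any long progression, so no density increment has to be iterated.

  The variables of a solution must be distinct, and this shapes the upper bound: every
  \<open>u\<close> with only boundedly many usable steps is discarded, not just those with none.
  This is affordable because a digraph of bounded out-degree has an independent set of proportional
  size. The resulting bound is linear in \<open>\<epsilon>\<close>; the exponent
  \<open>1 / 2\<close> merely absorbs its constant.

  In the lower bound concentration controls most coordinates, never all, so a proportion
  \<open>\<tau>\<close> of bad ones has to be tolerated; \<open>\<tau> < 1 / k\<close> still leaves
  one coordinate that is good for all \<open>k\<close> variables. The dimension is proportional to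
  \<open>ln (1 / \<epsilon>)\<close> and each dimension costs a constant factor of density, which
  together gives a power of \<open>\<epsilon>\<close>.\<close>

definition solution_free_int :: "'i set \<Rightarrow> ('i \<Rightarrow> int) \<Rightarrow> int set \<Rightarrow> bool" where
  "solution_free_int S c A \<longleftrightarrow> \<not> (\<exists>x. inj_on x S \<and> x ` S \<subseteq> A \<and> (\<Sum>s\<in>S. c s * x s) = 0)"

lemma solution_free_int_mono:
  "solution_free_int S c A \<Longrightarrow> B \<subseteq> A \<Longrightarrow> solution_free_int S c B"
  unfolding solution_free_int_def by blast

text \<open>The translation contributes \<open>a * sum c S = 0\<close>. All later uses of
  translation invariance in this section go through this fact.\<close>

lemma solution_free_int_affine:
  assumes "solution_free_int S c A" "b \<noteq> 0" "sum c S = 0"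
  shows "solution_free_int S c {t. a + b * t \<in> A}"
  unfolding solution_free_int_def
proof
  assume "\<exists>x. inj_on x S \<and> x ` S \<subseteq> {t. a + b * t \<in> A} \<and> (\<Sum>s\<in>S. c s * x s) = 0"
  then obtain x where x: "inj_on x S" "x ` S \<subseteq> {t. a + b * t \<in> A}" "(\<Sum>s\<in>S. c s * x s) = 0"
    by blast
  define y where "y s = a + b * x s" for s
  have "inj_on y S" using x(1) \<open>b \<noteq> 0\<close> by (auto simp: inj_on_def y_def)
  moreover have "y ` S \<subseteq> A" using x(2) by (auto simp: y_def)
  moreover have "(\<Sum>s\<in>S. c s * y s) = a * sum c S + b * (\<Sum>s\<in>S. c s * x s)"
    by (simp add: y_def sum_distrib_left sum.distrib algebra_simps)
  then have "(\<Sum>s\<in>S. c s * y s) = 0" using x(3) assms(3) by simp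
  ultimately show False using assms(1) unfolding solution_free_int_def by blast
qed

section \<open>Extremal solution-free sets in intervals and progressions\<close>

definition max_free :: "'i set \<Rightarrow> ('i \<Rightarrow> int) \<Rightarrow> nat \<Rightarrow> nat" where
  "max_free S c L = Max {card A | A. A \<subseteq> {0..<int L} \<and> solution_free_int S c A}"

lemma finite_max_free: "finite {card A | A. A \<subseteq> {0..<int L} \<and> solution_free_int S c A}"
  by (rule finite_subset[of _ "card ` Pow {0..<int L}"]) auto

lemma card_le_max_free:
  assumes "A \<subseteq> {0..<int L}" "solution_free_int S c A"
  shows "card A \<le> max_free S c L"
  unfolding max_free_def by (rule Max_ge[OF finite_max_free]) (use assms in blast)

lemma max_free_attained:
  assumes "S \<noteq> {}"
  shows "\<exists>A\<subseteq>{0..<int L}. solution_free_int S c A \<and> card A = max_free S c L"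
proof -
  have "solution_free_int S c {}" using assms by (auto simp: solution_free_int_def)
  then have "{card A | A. A \<subseteq> {0..<int L} \<and> solution_free_int S c A} \<noteq> {}" by blast
  from Max_in[OF finite_max_free this]
  have "max_free S c L \<in> {card A | A. A \<subseteq> {0..<int L} \<and> solution_free_int S c A}"
    unfolding max_free_def .
  then obtain A where "max_free S c L = card A" "A \<subseteq> {0..<int L}" "solution_free_int S c A"
    by (elim CollectE exE conjE)
  then show ?thesis by (intro exI[of _ A] conjI) simp_all
qed

lemma card_progression:
  fixes b :: int assumes "b \<noteq> 0"
  shows "card ((\<lambda>i. a + b * i) ` {0..<int L}) = L"
  using assms by (subst card_image) (auto simp: inj_on_def)

lemma card_Int_progression_le_max_free:
  assumes "solution_free_int S c A" "b \<noteq> 0" "sum c S = 0"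
  shows "card (A \<inter> (\<lambda>i. a + b * i) ` {0..<int L}) \<le> max_free S c L"
proof -
  define B where "B = {t\<in>{0..<int L}. a + b * t \<in> A}"
  have "solution_free_int S c B"
    by (rule solution_free_int_mono[OF solution_free_int_affine[OF assms, of a]]) (auto simp: B_def)
  then have "card B \<le> max_free S c L" by (intro card_le_max_free) (auto simp: B_def)
  moreover have "A \<inter> (\<lambda>i. a + b * i) ` {0..<int L} = (\<lambda>i. a + b * i) ` B"
    by (auto simp: B_def)
  moreover have "finite B" unfolding B_def by (rule finite_subset[of _ "{0..<int L}"]) auto
  ultimately show ?thesis using card_image_le[of B "\<lambda>i. a + b * i"] by simp
qed

lemma max_free_le:
  assumes "S \<noteq> {}" shows "max_free S c L \<le> L"
proof -
  obtain A where "A \<subseteq> {0..<int L}" "card A = max_free S c L" using max_free_attained[OF assms] by metis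
  then show ?thesis using card_mono[of "{0..<int L}" A] by simp
qed

lemma max_free_add:
  assumes "S \<noteq> {}" "sum c S = 0"
  shows "max_free S c (L + M) \<le> max_free S c L + max_free S c M"
proof -
  obtain A where A: "A \<subseteq> {0..<int (L + M)}" "solution_free_int S c A" "card A = max_free S c (L + M)"
    using max_free_attained[OF assms(1)] by metis
  have "A = (A \<inter> (\<lambda>i. 0 + 1 * i) ` {0..<int L}) \<union> (A \<inter> (\<lambda>i. int L + 1 * i) ` {0..<int M})"
    using A(1) by (fastforce simp: image_iff)
  then have "card A \<le> card (A \<inter> (\<lambda>i. 0 + 1 * i) ` {0..<int L}) + card (A \<inter> (\<lambda>i. int L + 1 * i) ` {0..<int M})"
    by (metis card_Un_le)
  also have "\<dots> \<le> max_free S c L + max_free S c M"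
    by (intro add_mono card_Int_progression_le_max_free A assms) auto
  finally show ?thesis using A by simp
qed

lemma max_free_mult:
  assumes "S \<noteq> {}" "sum c S = 0"
  shows "max_free S c (k * L) \<le> k * max_free S c L"
proof (induction k)
  case 0
  then show ?case using max_free_le[OF assms(1), of c 0] by simp
next
  case (Suc k)
  then show ?case using max_free_add[OF assms, of L "k * L"] by simp
qed

text \<open>Subadditivity, as in Fekete's lemma: cut \<open>L\<close> into \<open>L div N\<close>
  blocks of length \<open>N\<close> and a remainder, which costs at most \<open>N\<close>.\<close>

lemma max_free_le_linear:
  assumes "S \<noteq> {}" "sum c S = 0" "N > 0"
  shows "real (max_free S c L) \<le> real (max_free S c N) / N * L + N"
proof -
  have "max_free S c L \<le> max_free S c ((L div N) * N) + max_free S c (L mod N)"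
    using max_free_add[OF assms(1,2), of "(L div N) * N" "L mod N"] by simp
  also have "\<dots> \<le> (L div N) * max_free S c N + N"
    using max_free_mult[OF assms(1,2), of "L div N" N] max_free_le[OF assms(1), of c "L mod N"]
      mod_less_divisor[OF assms(3), of L] by linarith
  finally have "real (max_free S c L) \<le> real (L div N) * max_free S c N + N"
    by (metis of_nat_add of_nat_le_iff of_nat_mult)
  also have "real (L div N) \<le> real L / N" using of_nat_div_le_of_nat[of L N, where ?'a = real] by simp
  then have "real (L div N) * max_free S c N \<le> real L / N * max_free S c N"
    by (rule mult_right_mono) simp
  finally show ?thesis by (simp add: mult.commute)
qed

text \<open>Every maximal run with difference \<open>e\<close> inside \<open>E\<close> has exactly
  one start, a point \<open>x\<close> with \<open>x - e \<notin> E\<close>, so the additive loss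
  \<open>\<nu>\<close> is paid once for each start. The induction removes one run at a time.\<close>

lemma card_Int_le_progressions:
  fixes E A :: "int set" and e :: int and \<kappa> \<nu> :: real
  assumes "finite E" "e \<noteq> 0"
    and AP: "\<And>a L. real (card (A \<inter> (\<lambda>i. a + e * i) ` {0..<int L})) \<le> \<kappa> * L + \<nu>"
  shows "real (card (A \<inter> E)) \<le> \<kappa> * card E + \<nu> * card {x\<in>E. x - e \<notin> E}"
  using assms(1)
proof (induction "card E" arbitrary: E rule: less_induct)
  case (less E)
  show ?case
  proof (cases "E = {}")
    case False
    \<comment> \<open>Minimising \<open>e * x\<close> instead of \<open>x\<close> finds the start of
      a run for either sign of \<open>e\<close>.\<close>
    define x where "x = arg_min_on (\<lambda>x. e * x) E"
    have xE: "x \<in> E" unfolding x_def using less.prems False by (rule arg_min_if_finite)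
    have xmin: "\<not> e * y < e * x" if "y \<in> E" for y
      using arg_min_if_finite(2)[OF less.prems False, of "\<lambda>x. e * x"] that unfolding x_def by blast
    have "e * (x - e) < e * x" using \<open>e \<noteq> 0\<close> by (auto simp: algebra_simps zero_less_mult_iff)
    with xmin have xs: "x - e \<notin> E" by blast
    have "\<exists>l::nat. x + e * int l \<notin> E"
    proof (rule ccontr)
      assume "\<nexists>l::nat. x + e * int l \<notin> E"
      then have "range (\<lambda>l::nat. x + e * int l) \<subseteq> E" by auto
      moreover have "inj (\<lambda>l::nat. x + e * int l)" using \<open>e \<noteq> 0\<close> by (auto simp: inj_def)
      ultimately show False using less.prems finite_subset range_inj_infinite by blast
    qed
    define L where "L = (LEAST l::nat. x + e * int l \<notin> E)"
    have L1: "x + e * int L \<notin> E" unfolding L_def by (rule LeastI_ex) fact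
    have L2: "x + e * int l \<in> E" if "l < L" for l using not_less_Least[of l] that unfolding L_def by blast
    define P where "P = (\<lambda>i. x + e * i) ` {0..<int L}"
    have PE: "P \<subseteq> E"
    proof
      fix y assume "y \<in> P"
      then obtain i where i: "0 \<le> i" "i < int L" "y = x + e * i" by (auto simp: P_def)
      then have "nat i < L" by linarith
      from L2[OF this] show "y \<in> E" using i by simp
    qed
    have cP: "card P = L" unfolding P_def by (rule card_progression) fact
    have "L > 0" using L1 xE by (metis add.right_neutral gr0I mult_zero_right of_nat_0)
    then have xP: "x \<in> P" unfolding P_def by (intro image_eqI[of _ _ 0]) auto
    have finP: "finite P" unfolding P_def by simp
    have lt: "card (E - P) < card E" using xP PE less.prems by (intro psubset_card_mono) auto
    have sub: "{y\<in>E - P. y - e \<notin> E - P} \<subseteq> {y\<in>E. y - e \<notin> E} - {x}"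
    proof
      fix y assume y: "y \<in> {y\<in>E - P. y - e \<notin> E - P}"
      have "y - e \<notin> E"
      proof
        assume "y - e \<in> E"
        then have "y - e \<in> P" using y by blast
        then obtain i where i: "0 \<le> i" "i < int L" "y - e = x + e * i" by (auto simp: P_def)
        then have yy: "y = x + e * (i + 1)" by (simp add: algebra_simps)
        show False
        proof (cases "i + 1 < int L")
          case True
          then have "y \<in> P" unfolding P_def using yy i by (intro image_eqI[of _ _ "i + 1"]) auto
          then show False using y by blast
        next
          case False
          then have "i + 1 = int L" using i by linarith
          then show False using L1 yy y by simp
        qed
      qed
      then show "y \<in> {y\<in>E. y - e \<notin> E} - {x}" using y xP by blast
    qed
    have fs: "finite {y\<in>E. y - e \<notin> E}" using less.prems by simp
    have "\<nu> \<ge> 0" using AP[of 0 0] by simp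
    have "card {y\<in>E - P. y - e \<notin> E - P} \<le> card ({y\<in>E. y - e \<notin> E} - {x})"
      by (rule card_mono[OF _ sub]) (use fs in simp)
    also have "\<dots> = card {y\<in>E. y - e \<notin> E} - 1" using xE xs fs by simp
    finally have c1: "card {y\<in>E - P. y - e \<notin> E - P} + 1 \<le> card {y\<in>E. y - e \<notin> E}"
      using card_gt_0_iff[of "{y\<in>E. y - e \<notin> E}"] xE xs fs by fastforce
    have "A \<inter> E = (A \<inter> (E - P)) \<union> (A \<inter> P)" using PE by blast
    then have "card (A \<inter> E) \<le> card (A \<inter> (E - P)) + card (A \<inter> P)" by (metis card_Un_le)
    then have "real (card (A \<inter> E)) \<le> real (card (A \<inter> (E - P))) + real (card (A \<inter> P))"
      by linarith
    also have "\<dots> \<le> (\<kappa> * card (E - P) + \<nu> * card {y\<in>E - P. y - e \<notin> E - P}) + (\<kappa> * L + \<nu>)"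
      by (intro add_mono less.hyps lt) (use less.prems AP[of x L] in \<open>auto simp: P_def\<close>)
    also have "\<dots> = \<kappa> * (card (E - P) + card P) + \<nu> * (card {y\<in>E - P. y - e \<notin> E - P} + 1)"
      by (simp add: cP algebra_simps)
    also have "card (E - P) + card P = card E" using PE finP less.prems
      by (metis card_Diff_subset card_mono le_add_diff_inverse2)
    also have "\<nu> * (card {y\<in>E - P. y - e \<notin> E - P} + 1) \<le> \<nu> * card {y\<in>E. y - e \<notin> E}"
      using c1 \<open>\<nu> \<ge> 0\<close> by (intro mult_left_mono) auto
    finally show ?thesis by simp
  qed simp
qed

section \<open>Hilbert cubes in dense sets of integers\<close>

lemma Bonferroni_lower:
  fixes W :: "nat \<Rightarrow> 'a set"
  assumes "\<And>i. i < m \<Longrightarrow> finite (W i)"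
  shows "(\<Sum>i<m. card (W i)) \<le> card (\<Union>i<m. W i) + (\<Sum>j<m. \<Sum>i<j. card (W i \<inter> W j))"
  using assms
proof (induction m)
  case 0
  then show ?case by simp
next
  case (Suc m)
  have fin: "finite (\<Union>i<m. W i)" "finite (W m)" using Suc.prems by auto
  have "(\<Union>i<m. W i) \<inter> W m = (\<Union>i<m. W i \<inter> W m)" by blast
  then have "card ((\<Union>i<m. W i) \<inter> W m) \<le> (\<Sum>i<m. card (W i \<inter> W m))"
    by (metis card_UN_le finite_lessThan)
  moreover have "card ((\<Union>i<m. W i) \<union> W m) + card ((\<Union>i<m. W i) \<inter> W m) = card (\<Union>i<m. W i) + card (W m)"
    using card_Un_Int[OF fin] by simp
  moreover have "(\<Union>i<Suc m. W i) = (\<Union>i<m. W i) \<union> W m" by (auto simp: less_Suc_eq)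
  ultimately show ?case using Suc by simp
qed

text \<open>The translates \<open>W + i\<close> with \<open>i < m\<close> have total size at least
  \<open>5 * N\<close> but lie in an interval of at most \<open>3 * N\<close> integers. By
  Bonferroni their pairwise overlaps, each governed by a difference below \<open>m\<close>, cannot
  all have fewer than \<open>N / m^2\<close> elements.\<close>

lemma popular_difference:
  fixes \<omega> :: real
  assumes "m * \<omega> \<ge> 5" "N \<ge> m" "N \<ge> 1" "W \<subseteq> {- int N..int N}" "real (card W) \<ge> \<omega> * N"
  shows "\<exists>h. 0 < h \<and> h \<le> int m \<and> real (card {w\<in>W. w + h \<in> W}) \<ge> 1 / (real m)\<^sup>2 * N"
proof (rule ccontr)
  assume neg: "\<not> ?thesis"
  have finW: "finite W" using assms(4) finite_subset by blast
  have "m > 0" using assms(1) by (intro gr0I) auto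
  define V where "V i = (\<lambda>w. w + int i) ` W" for i :: nat
  have cV: "card (V i) = card W" for i unfolding V_def by (intro card_image) (auto simp: inj_on_def)
  have VV: "real (card (V i \<inter> V j)) \<le> N / (real m)\<^sup>2" if "i < j" "j < m" for i j
  proof -
    have "V i \<inter> V j \<subseteq> (\<lambda>w. w + int j) ` {w\<in>W. w + (int j - int i) \<in> W}"
    proof
      fix y assume "y \<in> V i \<inter> V j"
      then obtain w w' where w: "w \<in> W" "w' \<in> W" "y = w + int i" "y = w' + int j" by (auto simp: V_def)
      then have "w = w' + (int j - int i)" by simp
      with w show "y \<in> (\<lambda>w. w + int j) ` {w\<in>W. w + (int j - int i) \<in> W}" by blast
    qed
    then have "card (V i \<inter> V j) \<le> card ((\<lambda>w. w + int j) ` {w\<in>W. w + (int j - int i) \<in> W})"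
      using finW by (intro card_mono) auto
    also have "\<dots> \<le> card {w\<in>W. w + (int j - int i) \<in> W}" using finW by (intro card_image_le) auto
    finally have "real (card (V i \<inter> V j)) \<le> card {w\<in>W. w + (int j - int i) \<in> W}" by simp
    also have "\<dots> \<le> N / (real m)\<^sup>2"
    proof -
      have "0 < int j - int i" "int j - int i \<le> int m" using that by auto
      with neg have "\<not> real (card {w\<in>W. w + (int j - int i) \<in> W}) \<ge> 1 / (real m)\<^sup>2 * N" by blast
      then show ?thesis by simp
    qed
    finally show ?thesis .
  qed
  have "(\<Union>i<m. V i) \<subseteq> {- int N..int N + int m - 1}" using assms(4) by (force simp: V_def)
  then have "card (\<Union>i<m. V i) \<le> card {- int N..int N + int m - 1}" by (intro card_mono) auto
  also have "\<dots> \<le> 3 * N" using assms(2) \<open>m > 0\<close> by simp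
  finally have U: "card (\<Union>i<m. V i) \<le> 3 * N" .
  have "real (\<Sum>j<m. \<Sum>i<j. card (V i \<inter> V j)) = (\<Sum>j<m. \<Sum>i<j. real (card (V i \<inter> V j)))" by simp
  also have "\<dots> \<le> (\<Sum>j<m. \<Sum>i<j. N / (real m)\<^sup>2)" by (intro sum_mono VV) auto
  also have "\<dots> \<le> (\<Sum>j<m. real m * (N / (real m)\<^sup>2))" by (intro sum_mono) (auto simp: divide_right_mono mult_right_mono)
  also have "\<dots> = N" using \<open>m > 0\<close> by (simp add: power2_eq_square)
  finally have P: "(\<Sum>j<m. \<Sum>i<j. card (V i \<inter> V j)) \<le> N" by linarith
  have "finite (V i)" for i using finW by (simp add: V_def)
  then have "(\<Sum>i<m. card (V i)) \<le> 3 * N + N"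
    using Bonferroni_lower[of m V] U P by fastforce
  then have "m * card W \<le> 3 * N + N" by (simp add: cV)
  then have "real (m * card W) \<le> real (4 * N)" by (subst of_nat_le_iff) linarith
  then have "real m * real (card W) \<le> 4 * N" by simp
  moreover have "real m * (\<omega> * N) \<le> real m * real (card W)" using assms(5) by (intro mult_left_mono) auto
  moreover have "5 * real N \<le> m * \<omega> * N" using assms(1) by (intro mult_right_mono) auto
  ultimately show False using assms(3) by (simp add: mult.assoc)
qed

text \<open>\<open>Q j\<close> is the Hilbert cube of dimension \<open>j\<close>: a base point plus
  all subset sums of \<open>h 0, ..., h (j - 1)\<close>. The whole chain is recorded because an
  intermediate level will be selected. Subset sums may coincide, so \<open>2 ^ j\<close> only bounds
  the size from above.\<close>

definition cube_chain :: "nat \<Rightarrow> (nat \<Rightarrow> int set) \<Rightarrow> (nat \<Rightarrow> int) \<Rightarrow> bool" where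
  "cube_chain d Q h \<longleftrightarrow> (\<exists>q. Q 0 = {q}) \<and> (\<forall>j<d. 0 < h j \<and> Q (Suc j) = Q j \<union> (\<lambda>q. q + h j) ` Q j)"

lemma cube_chain_props:
  assumes "cube_chain d Q h" "j \<le> d"
  shows "finite (Q j)" "card (Q j) \<le> 2 ^ j" "Q j \<noteq> {}" "Q j \<subseteq> Q d"
proof -
  have "finite (Q j) \<and> card (Q j) \<le> 2 ^ j \<and> Q j \<noteq> {}" using assms(2)
  proof (induction j)
    case 0
    then show ?case using assms(1) by (auto simp: cube_chain_def)
  next
    case (Suc j)
    then have Q: "Q (Suc j) = Q j \<union> (\<lambda>q. q + h j) ` Q j" using assms(1) by (auto simp: cube_chain_def)
    have "card (Q j \<union> (\<lambda>q. q + h j) ` Q j) \<le> card (Q j) + card (Q j)"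
      using card_Un_le[of "Q j"] card_image_le[of "Q j" "\<lambda>q. q + h j"] Suc by (meson Suc_leD add_left_mono le_trans)
    then show ?case using Suc Q by auto
  qed
  then show "finite (Q j)" "card (Q j) \<le> 2 ^ j" "Q j \<noteq> {}" by auto
  have "\<And>j. j < d \<Longrightarrow> Q j \<subseteq> Q (Suc j)" using assms(1) by (auto simp: cube_chain_def)
  with assms(2) show "Q j \<subseteq> Q d"
    by (induction rule: inc_induct) blast+
qed

text \<open>For a popular difference \<open>g\<close> the set of \<open>w\<close> with
  \<open>w\<close> and \<open>w + g\<close> in \<open>W\<close> is still dense. A cube inside it
  stays inside \<open>W\<close> when \<open>g\<close> is added as the last direction.
  \<open>H\<close> does not depend on \<open>N\<close> or \<open>W\<close>, which keeps the later
  boundary effects bounded.\<close>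

lemma Hilbert_cube:
  fixes \<omega> :: real
  assumes "\<omega> > 0"
  shows "\<exists>H N0. \<forall>N\<ge>N0. \<forall>W\<subseteq>{- int N..int N}. real (card W) \<ge> \<omega> * N \<longrightarrow>
    (\<exists>Q h. cube_chain d Q h \<and> (\<forall>j<d. h j \<le> int H) \<and> Q d \<subseteq> W)"
  using assms
proof (induction d arbitrary: \<omega>)
  case 0
  have "\<exists>Q h. cube_chain 0 Q h \<and> (\<forall>j<(0::nat). h j \<le> int 0) \<and> Q 0 \<subseteq> W"
    if "N \<ge> 1" "real (card W) \<ge> \<omega> * N" for N :: nat and W
  proof -
    have "\<omega> * N > 0" using 0 that(1) by simp
    then have "card W \<noteq> 0" using that(2) by linarith
    then obtain w where "w \<in> W" by fastforce
    then show ?thesis by (intro exI[of _ "\<lambda>_. {w}"]) (auto simp: cube_chain_def)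
  qed
  then show ?case by blast
next
  case (Suc d)
  obtain m :: nat where m: "m * \<omega> \<ge> 5"
    using Suc.prems by (metis divide_le_eq real_arch_simple)
  then have "m > 0" by (intro gr0I) auto
  then have "1 / (real m)\<^sup>2 > 0" by simp
  from Suc.IH[OF this] obtain H N0 where IH:
    "\<forall>N\<ge>N0. \<forall>W\<subseteq>{- int N..int N}. real (card W) \<ge> 1 / (real m)\<^sup>2 * N \<longrightarrow>
      (\<exists>Q h. cube_chain d Q h \<and> (\<forall>j<d. h j \<le> int H) \<and> Q d \<subseteq> W)"
    by (elim exE)
  have "\<exists>Q h. cube_chain (Suc d) Q h \<and> (\<forall>j<Suc d. h j \<le> int (H + m)) \<and> Q (Suc d) \<subseteq> W"
    if N: "N \<ge> N0 + m + 1" and W: "W \<subseteq> {- int N..int N}" "real (card W) \<ge> \<omega> * N" for N W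
  proof -
    have "m \<le> N" "1 \<le> N" using N by auto
    from popular_difference[OF m this W] obtain g
      where g: "0 < g" "g \<le> int m" "real (card {w\<in>W. w + g \<in> W}) \<ge> 1 / (real m)\<^sup>2 * N"
      by (elim exE conjE)
    have "{w\<in>W. w + g \<in> W} \<subseteq> {- int N..int N}" using W by blast
    moreover have "N \<ge> N0" using N by simp
    ultimately have "\<exists>Q h. cube_chain d Q h \<and> (\<forall>j<d. h j \<le> int H) \<and> Q d \<subseteq> {w\<in>W. w + g \<in> W}"
      using IH g(3) by blast
    then obtain Q h where
      Q: "cube_chain d Q h" "\<forall>j<d. h j \<le> int H" "Q d \<subseteq> {w\<in>W. w + g \<in> W}" by blast
    define Q' where "Q' = Q(Suc d := Q d \<union> (\<lambda>q. q + g) ` Q d)"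
    define h' where "h' = h(d := g)"
    have "cube_chain (Suc d) Q' h'"
      using Q(1) g(1) by (auto simp: cube_chain_def Q'_def h'_def less_Suc_eq)
    moreover have "\<forall>j<Suc d. h' j \<le> int (H + m)"
      using Q(2) g(2) by (force simp: h'_def less_Suc_eq)
    moreover have "Q' (Suc d) \<subseteq> W" using Q(3) by (auto simp: Q'_def)
    ultimately show ?thesis by blast
  qed
  then have "\<forall>N\<ge>N0 + m + 1. \<forall>W\<subseteq>{- int N..int N}. real (card W) \<ge> \<omega> * N \<longrightarrow>
      (\<exists>Q h. cube_chain (Suc d) Q h \<and> (\<forall>j<Suc d. h j \<le> int (H + m)) \<and> Q (Suc d) \<subseteq> W)"
    by simp
  then show ?case by blast
qed

section \<open>The density argument for Roth's theorem\<close>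

lemma exists_small_increment:
  fixes f :: "nat \<Rightarrow> nat"
  assumes "d > 0" "f d \<le> B"
  shows "\<exists>j<d. real (f (Suc j)) - real (f j) \<le> real B / d"
proof (rule ccontr)
  assume "\<not> ?thesis"
  then have "(\<Sum>j<d. real B / d) < (\<Sum>j<d. real (f (Suc j)) - real (f j))"
    using \<open>d > 0\<close> by (intro sum_strict_mono) auto
  also have "\<dots> = real (f d) - real (f 0)" by (rule sum_lessThan_telescope)
  finally show False using assms by simp
qed

text \<open>
  This is the combinatorial proof of Roth's theorem by Hilbert cubes: \<open>D j\<close> below is the set of values
  that the variable \<open>a\<close> is forced to avoid when \<open>g\<close> ranges over the \<open>j\<close>-th cube and \<open>b\<close> over
  \<open>W\<close>. Some \<open>D j\<close> is almost invariant under a bounded shift, so its complement, which contains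
  almost all of \<open>A\<close>, is a union of few long progressions.
\<close>

lemma card_solution_free_le:
  fixes S :: "'i set" and c :: "'i \<Rightarrow> int" and \<kappa> \<nu> :: real
  assumes S: "finite S" "a \<in> S" "b \<in> S" "g \<in> S" "a \<noteq> b" "a \<noteq> g" "b \<noteq> g"
    and c: "\<And>s. s \<in> S \<Longrightarrow> c s \<noteq> 0" "c a + c b \<noteq> 0"
    and A: "solution_free_int S c A" "A \<subseteq> {- int N..int N}"
    and AP: "\<And>e a L. e \<noteq> 0 \<Longrightarrow> real (card (A \<inter> (\<lambda>i. a + e * i) ` {0..<int L})) \<le> \<kappa> * L + \<nu>"
    and x0: "inj_on x0 (S - {a, b, g})" "x0 ` (S - {a, b, g}) \<subseteq> A"
    and W: "W \<subseteq> A" "W \<inter> x0 ` (S - {a, b, g}) = {}"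
    and mult: "\<And>x. x \<in> W \<union> x0 ` (S - {a, b, g}) \<Longrightarrow> c a dvd x \<and> (\<Sum>s\<in>S. \<bar>c s\<bar>) * \<bar>x\<bar> \<le> int N"
    and Q: "cube_chain d Q h" "\<And>j. j < d \<Longrightarrow> h j \<le> int H" "Q d \<subseteq> W" "d > 0"
    and \<kappa>: "\<kappa> \<ge> 0"
  shows "real (card A) \<le> \<kappa> * (2 * N + 1 - real (card W)) + \<nu> * ((2 * N + 1) / d + (\<Sum>s\<in>S. \<bar>c s\<bar>) * (2 * H))
           + (3 * 2 ^ d + card S)"
proof -
  define R where "R = S - {a, b, g}"
  define C where "C = (\<Sum>s\<in>S. \<bar>c s\<bar>)"
  define K where "K = (\<Sum>s\<in>R. c s * x0 s)"
  define D where "D j = {y. \<exists>q\<in>Q j. \<exists>w\<in>W. c a * y + c g * q + c b * w + K = 0}" for j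
  have ca: "c a \<noteq> 0" "c b \<noteq> 0" "c g \<noteq> 0" using S c by auto
  have SR: "S = insert a (insert b (insert g R))" and finR: "finite R" and notR: "a \<notin> R" "b \<notin> R" "g \<notin> R"
    using S by (auto simp: R_def)
  have sumS: "(\<Sum>s\<in>S. f s) = f a + (f b + (f g + (\<Sum>s\<in>R. f s)))" for f :: "'i \<Rightarrow> int"
    unfolding SR using finR notR S(5-7) by simp
  have C_eq: "C = \<bar>c a\<bar> + (\<bar>c b\<bar> + (\<bar>c g\<bar> + (\<Sum>s\<in>R. \<bar>c s\<bar>)))" unfolding C_def by (rule sumS)
  have R_nonneg: "(\<Sum>s\<in>R. \<bar>c s\<bar>) \<ge> 0" by (rule sum_nonneg) simp
  have C_pos: "C > 0" using C_eq ca R_nonneg by linarith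
  have finA: "finite A" using A(2) finite_subset by blast
  have finW: "finite W" using W(1) finA finite_subset by blast
  have \<nu>: "\<nu> \<ge> 0" using AP[of 1 0 0] by simp
  have QW: "Q j \<subseteq> W" if "j \<le> d" for j using cube_chain_props(4)[OF Q(1) that] Q(3) by blast
  \<comment> \<open>The condition \<open>C * \<bar>x\<bar> \<le> N\<close> on the other values
    leaves room for the forced one: \<open>C * \<bar>c a * y\<bar>\<close> is at most
    \<open>(C - \<bar>c a\<bar>) * N\<close>.\<close>
  have D_sub: "D j \<subseteq> {- int N..int N}" if "j \<le> d" for j
  proof
    fix y assume "y \<in> D j"
    then obtain q w where q: "q \<in> Q j" "w \<in> W" "c a * y + c g * q + c b * w + K = 0" by (auto simp: D_def)
    then have qW: "q \<in> W" using QW[OF that] by blast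
    have "\<bar>c a * y\<bar> = \<bar>c g * q + c b * w + K\<bar>" using q(3) by linarith
    also have "\<dots> \<le> \<bar>c g * q\<bar> + \<bar>c b * w\<bar> + \<bar>K\<bar>" by linarith
    also have "\<bar>K\<bar> \<le> (\<Sum>s\<in>R. \<bar>c s * x0 s\<bar>)" unfolding K_def by (rule sum_abs)
    finally have "C * \<bar>c a * y\<bar> \<le> C * (\<bar>c g * q\<bar> + \<bar>c b * w\<bar> + (\<Sum>s\<in>R. \<bar>c s * x0 s\<bar>))"
      using C_pos by simp
    also have "\<dots> = \<bar>c g\<bar> * (C * \<bar>q\<bar>) + \<bar>c b\<bar> * (C * \<bar>w\<bar>) + (\<Sum>s\<in>R. \<bar>c s\<bar> * (C * \<bar>x0 s\<bar>))"
      by (simp add: algebra_simps abs_mult sum_distrib_left)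
    also have "\<dots> \<le> \<bar>c g\<bar> * int N + \<bar>c b\<bar> * int N + (\<Sum>s\<in>R. \<bar>c s\<bar> * int N)"
      using mult q qW by (intro add_mono sum_mono mult_left_mono) (auto simp: C_def R_def)
    also have "\<dots> = (C - \<bar>c a\<bar>) * int N" by (simp add: C_eq algebra_simps sum_distrib_left)
    also have "\<dots> \<le> C * int N" by (intro mult_right_mono) auto
    finally have "\<bar>c a * y\<bar> \<le> int N" using C_pos by simp
    moreover have "\<bar>y\<bar> \<le> \<bar>c a * y\<bar>" using mult_right_mono[of 1 "\<bar>c a\<bar>" "\<bar>y\<bar>"] ca(1) by (simp add: abs_mult)
    ultimately show "y \<in> {- int N..int N}" by auto
  qed
  then have finD: "finite (D j)" if "j \<le> d" for j using that finite_subset by blast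
  have cardD: "card (D j) \<le> 2 * N + 1" if "j \<le> d" for j
    using card_mono[OF _ D_sub[OF that]] by simp
  \<comment> \<open>Both \<open>q\<close> and \<open>q + h j\<close> are multiples of
    \<open>c a\<close>, hence so is \<open>h j\<close>. Moving \<open>q\<close> by
    \<open>h j\<close> therefore moves the forced value by an integer, independently of
    \<open>w\<close>.\<close>
  have D_Un: "D (Suc j) = D j \<union> (\<lambda>y. y - c g * h j div c a) ` D j"
    and e_nz: "c g * h j div c a \<noteq> 0" and e_le: "\<bar>c g * h j div c a\<bar> \<le> C * H" if "j < d" for j
  proof -
    have Qs: "Q (Suc j) = Q j \<union> (\<lambda>q. q + h j) ` Q j" "0 < h j" using Q(1) that by (auto simp: cube_chain_def)
    have "Q j \<noteq> {}" using cube_chain_props(3)[OF Q(1), of j] that by simp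
    then obtain q where "q \<in> Q j" by blast
    then have "q \<in> W" "q + h j \<in> W" using QW[of "Suc j"] Qs(1) that by auto
    then have "c a dvd q" "c a dvd (q + h j)" using mult by auto
    then have "c a dvd h j" by (simp add: dvd_add_right_iff)
    then obtain h' where h': "h j = c a * h'" by blast
    have e: "c g * h j div c a = c g * h'" using ca by (simp add: h' mult.left_commute)
    show "c g * h j div c a \<noteq> 0" using e ca h' Qs(2) by auto
    have "\<bar>h'\<bar> \<le> \<bar>h j\<bar>" using mult_right_mono[of 1 "\<bar>c a\<bar>" "\<bar>h'\<bar>"] ca(1) by (simp add: h' abs_mult)
    then have "\<bar>h'\<bar> \<le> int H" using Qs(2) Q(2)[OF that] by simp
    moreover have "\<bar>c g\<bar> \<le> C" using C_eq R_nonneg by linarith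
    ultimately show "\<bar>c g * h j div c a\<bar> \<le> C * H"
      using C_pos by (simp add: e abs_mult mult_mono)
    have "y \<in> D (Suc j) \<longleftrightarrow> y \<in> D j \<or> y + c g * h' \<in> D j" for y
    proof -
      have "y \<in> D (Suc j) \<longleftrightarrow> y \<in> D j \<or> (\<exists>q\<in>Q j. \<exists>w\<in>W. c a * y + c g * (q + h j) + c b * w + K = 0)"
        unfolding D_def Qs(1) by blast
      moreover have "c a * y + c g * (q + h j) + c b * w + K = c a * (y + c g * h') + c g * q + c b * w + K" for q w
        by (simp add: h' algebra_simps)
      ultimately show ?thesis unfolding D_def by simp
    qed
    moreover have mem_shift: "y \<in> (\<lambda>y. y - t) ` D j \<longleftrightarrow> y + t \<in> D j" for y t
      unfolding image_iff by (auto intro: bexI[of _ "y + t"])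
    ultimately show "D (Suc j) = D j \<union> (\<lambda>y. y - c g * h j div c a) ` D j"
      unfolding e set_eq_iff Un_iff using mem_shift by blast
  qed
  obtain j where j: "j < d" "real (card (D (Suc j))) - real (card (D j)) \<le> real (2 * N + 1) / d"
    using exists_small_increment[of d "\<lambda>j. card (D j)" "2 * N + 1"] Q(4) cardD by blast
  \<comment> \<open>For one fixed \<open>q\<close>, different \<open>w\<close> force different
    values, and divisibility by \<open>c a\<close> makes each of these an integer.\<close>
  have W_le: "card W \<le> card (D j)"
  proof -
    have "Q j \<noteq> {}" using cube_chain_props(3)[OF Q(1), of j] j by simp
    then obtain q where q: "q \<in> Q j" by blast
    define f where "f w = (- (c g * q + c b * w + K)) div c a" for w
    have "c a dvd K" unfolding K_def using mult by (intro dvd_sum) (auto simp: R_def)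
    moreover have "c a dvd q" using mult q QW[of j] j by auto
    ultimately have f: "c a * f w = - (c g * q + c b * w + K)" if "w \<in> W" for w
      unfolding f_def using mult that by (intro dvd_mult_div_cancel) (auto intro!: dvd_add dvd_minus_iff[THEN iffD2] simp del: minus_add_distrib)
    have "f ` W \<subseteq> D j"
    proof (intro image_subsetI)
      fix w assume w: "w \<in> W"
      have "c a * f w + c g * q + c b * w + K = 0" using f[OF w] by simp
      then show "f w \<in> D j" unfolding D_def using q w by blast
    qed
    moreover have "inj_on f W"
    proof
      fix w w' assume "w \<in> W" "w' \<in> W" "f w = f w'"
      then have "c g * q + c b * w + K = c g * q + c b * w' + K" using f by (metis neg_equal_iff_equal)
      then show "w = w'" using ca by simp
    qed
    ultimately show ?thesis using finD[of j] j by (metis card_inj_on_le less_imp_le_nat)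
  qed
  \<comment> \<open>An element of \<open>A\<close> in \<open>D j\<close> completes a solution, so
    two of the values must coincide. \<open>B1\<close> collects the case \<open>w = q\<close>, and
    \<open>B2\<close> the case \<open>w = y\<close>, where \<open>c a + c b \<noteq> 0\<close>
    determines \<open>y\<close> from \<open>q\<close>. Otherwise \<open>y\<close> lies in the cube
    or among the values of \<open>x0\<close>. All these sets have bounded size.\<close>
  have AD: "card (A \<inter> D j) \<le> 3 * 2 ^ d + card S"
  proof -
    define B1 where "B1 = (\<lambda>q. (- (c g * q + c b * q + K)) div c a) ` Q j"
    define B2 where "B2 = (\<lambda>q. (- (c g * q + K)) div (c a + c b)) ` Q j"
    have "A \<inter> D j \<subseteq> Q j \<union> B1 \<union> B2 \<union> x0 ` R"
    proof
      fix y assume y: "y \<in> A \<inter> D j"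
      then obtain q w where q: "q \<in> Q j" "w \<in> W" "c a * y + c g * q + c b * w + K = 0" by (auto simp: D_def)
      have qW: "q \<in> W" using QW[of j] j q by auto
      have B1: "y \<in> B1" if "w = q"
      proof -
        have "c a * y = - (c g * q + c b * q + K)" using q that by simp
        then have "y = (- (c g * q + c b * q + K)) div c a" using ca by (metis nonzero_mult_div_cancel_left)
        then show ?thesis unfolding B1_def using q by blast
      qed
      have B2: "y \<in> B2" if "w = y"
      proof -
        have "(c a + c b) * y = - (c g * q + K)" using q that by (simp add: algebra_simps)
        then have "y = (- (c g * q + K)) div (c a + c b)" using c(2) by (metis nonzero_mult_div_cancel_left)
        then show ?thesis unfolding B2_def using q by blast
      qed
      show "y \<in> Q j \<union> B1 \<union> B2 \<union> x0 ` R"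
      proof (rule ccontr)
        assume n: "y \<notin> Q j \<union> B1 \<union> B2 \<union> x0 ` R"
        define x where "x = x0(a := y, b := w, g := q)"
        have xR: "x s = x0 s" if "s \<in> R" for s using that notR by (auto simp: x_def)
        have xx: "x a = y" "x b = w" "x g = q" using S(5-7) by (auto simp: x_def)
        have img: "x ` R = x0 ` R" using xR by simp
        have "inj_on x R" using x0(1) inj_on_cong[of R x x0] xR unfolding R_def[symmetric] by blast
        moreover have "w \<notin> x0 ` R" "q \<notin> x0 ` R" using W(2) q qW by (auto simp: R_def)
        moreover have "w \<noteq> q" "w \<noteq> y" "y \<noteq> q" using n B1 B2 q by auto
        ultimately have "inj_on x S"
          unfolding SR using notR S(5-7) n by (auto simp: inj_on_insert xx img)
        moreover have "x ` S \<subseteq> A"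
          unfolding SR using xx img x0(2) y q qW W(1) by (auto simp: R_def)
        moreover have "(\<Sum>s\<in>S. c s * x s) = 0"
          unfolding sumS using q(3) xx xR by (simp add: K_def)
        ultimately show False using A(1) unfolding solution_free_int_def by blast
      qed
    qed
    moreover have fin: "finite (Q j)" and cQ: "card (Q j) \<le> 2 ^ j" using cube_chain_props[OF Q(1), of j] j by auto
    ultimately have "card (A \<inter> D j) \<le> card (Q j \<union> B1 \<union> B2 \<union> x0 ` R)"
      using finR by (intro card_mono) (auto simp: B1_def B2_def)
    also have "\<dots> \<le> card (Q j) + card B1 + card B2 + card (x0 ` R)"
      by (meson card_Un_le add_right_mono le_trans)
    also have "card B1 \<le> card (Q j)" unfolding B1_def using fin by (rule card_image_le)
    also have "card B2 \<le> card (Q j)" unfolding B2_def using fin by (rule card_image_le)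
    also have "card (x0 ` R) \<le> card S"
      using card_image_le[OF finR, of x0] card_mono[of S R] S(1) by (simp add: R_def)
    also have "card (Q j) + card (Q j) + card (Q j) + card S \<le> 3 * 2 ^ d + card S"
    proof -
      have "(2::nat) ^ j \<le> 2 ^ d" using j by (intro power_increasing) auto
      with cQ show ?thesis by linarith
    qed
    finally show ?thesis by simp
  qed
  define e where "e = c g * h j div c a"
  define E where "E = {- int N..int N} - D j"
  \<comment> \<open>A step by \<open>e\<close> leaves \<open>E\<close> either near the ends of the
    interval or by entering \<open>D j\<close>; in the latter case \<open>x\<close> is one of the
    few new elements of \<open>D (Suc j)\<close>. So \<open>E\<close> consists of few progressions
    with difference \<open>- e\<close>.\<close>
  have "{x\<in>E. x - (- e) \<notin> E} \<subseteq> ({int N - \<bar>e\<bar><..int N} \<union> {- int N..< - int N + \<bar>e\<bar>}) \<union> (D (Suc j) - D j)"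
  proof
    fix x assume x: "x \<in> {x\<in>E. x - (- e) \<notin> E}"
    show "x \<in> ({int N - \<bar>e\<bar><..int N} \<union> {- int N..< - int N + \<bar>e\<bar>}) \<union> (D (Suc j) - D j)"
    proof (cases "x + e \<in> D j")
      case True
      then have "x \<in> D (Suc j)" unfolding D_Un[OF j(1)] e_def[symmetric] by (intro UnI2 image_eqI[of _ _ "x + e"]) auto
      then show ?thesis using x by (auto simp: E_def)
    next
      case False
      then show ?thesis using x by (auto simp: E_def)
    qed
  qed
  then have "card {x\<in>E. x - (- e) \<notin> E} \<le> card (({int N - \<bar>e\<bar><..int N} \<union> {- int N..< - int N + \<bar>e\<bar>}) \<union> (D (Suc j) - D j))"
    using finD[of "Suc j"] j by (intro card_mono) auto
  also have "\<dots> \<le> card ({int N - \<bar>e\<bar><..int N} \<union> {- int N..< - int N + \<bar>e\<bar>}) + card (D (Suc j) - D j)"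
    by (rule card_Un_le)
  finally have "real (card {x\<in>E. x - (- e) \<notin> E}) \<le> real (2 * nat \<bar>e\<bar>) + real (card (D (Suc j) - D j))"
    using card_Un_le[of "{int N - \<bar>e\<bar><..int N}" "{- int N..< - int N + \<bar>e\<bar>}"] by simp
  also have "card (D (Suc j) - D j) = card (D (Suc j)) - card (D j)"
    using D_Un[OF j(1)] finD[of j] j(1) by (intro card_Diff_subset) auto
  also have "real (card (D (Suc j)) - card (D j)) = real (card (D (Suc j))) - real (card (D j))"
    using D_Un[OF j(1)] finD[of "Suc j"] j(1) by (intro of_nat_diff card_mono) auto
  also have "real (2 * nat \<bar>e\<bar>) \<le> real_of_int (C * (2 * H))"
    using e_le[OF j(1)] unfolding e_def[symmetric] by linarith
  finally have starts: "real (card {x\<in>E. x - (- e) \<notin> E}) \<le> (2 * N + 1) / d + C * (2 * H)"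
    using j(2) by simp
  have "card E = card {- int N..int N} - card (D j)"
    unfolding E_def using finD[of j] D_sub[of j] j(1) by (intro card_Diff_subset) auto
  then have cE: "real (card E) \<le> 2 * N + 1 - real (card W)"
    using W_le cardD[of j] j(1) by (simp add: of_nat_diff)
  have "real (card (A \<inter> E)) \<le> \<kappa> * card E + \<nu> * card {x\<in>E. x - (- e) \<notin> E}"
    using e_nz[OF j(1)] by (intro card_Int_le_progressions AP) (auto simp: E_def e_def)
  also have "\<dots> \<le> \<kappa> * (2 * N + 1 - real (card W)) + \<nu> * ((2 * N + 1) / d + C * (2 * H))"
    using \<kappa> \<nu> cE starts by (intro add_mono mult_left_mono) auto
  finally have AE: "real (card (A \<inter> E)) \<le> \<kappa> * (2 * N + 1 - real (card W)) + \<nu> * ((2 * N + 1) / d + C * (2 * H))" .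
  have "A = (A \<inter> E) \<union> (A \<inter> D j)" using A(2) by (auto simp: E_def)
  then have "card A \<le> card (A \<inter> E) + card (A \<inter> D j)" by (metis card_Un_le)
  then have "real (card A) \<le> real (card (A \<inter> E)) + real (3 * 2 ^ d + card S)" using AD by linarith
  then show ?thesis using AE by (simp add: C_def algebra_simps)
qed

text \<open>A lower bound on the multiples of \<open>M\<close> obtained by subtraction. The rest of
  the interval consists of \<open>M - 1\<close> other residue classes and two end pieces, that is,
  \<open>M + 1\<close> progressions of total length \<open>2 * N + 1 - 2 * b\<close>, and
  \<open>A\<close> obeys the upper bound on each of them.\<close>

lemma card_le_multiples:
  fixes A :: "int set" and \<kappa> \<nu> :: real
  assumes "M > 0" "M * b \<le> N" "A \<subseteq> {- int N..int N}"
    and AP: "\<And>e a L. e \<noteq> 0 \<Longrightarrow> real (card (A \<inter> (\<lambda>i. a + e * i) ` {0..<int L})) \<le> \<kappa> * L + \<nu>"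
  shows "real (card A) \<le> card (A \<inter> (\<lambda>i. - int (M * b) + int M * i) ` {0..<int (2 * b)})
           + \<kappa> * (2 * N + 1 - 2 * real b) + (M + 1) * \<nu>"
proof -
  define P where "P r = (\<lambda>i. (int r - int (M * b)) + int M * i) ` {0..<int (2 * b)}" for r
  define Pl where "Pl = (\<lambda>i. - int N + 1 * i) ` {0..<int (N - M * b)}"
  define Pr where "Pr = (\<lambda>i. int (M * b) + 1 * i) ` {0..<int (N - M * b + 1)}"
  have "A \<subseteq> (A \<inter> Pl \<union> A \<inter> Pr) \<union> (\<Union>r<M. A \<inter> P r)"
  proof
    fix x assume x: "x \<in> A"
    then have xN: "- int N \<le> x" "x \<le> int N" using assms(3) by auto
    show "x \<in> (A \<inter> Pl \<union> A \<inter> Pr) \<union> (\<Union>r<M. A \<inter> P r)"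
    proof (cases "x < - int (M * b) \<or> x \<ge> int (M * b)")
      case True
      then show ?thesis
      proof
        assume "x < - int (M * b)"
        then have "x \<in> Pl" unfolding Pl_def using xN assms(2) by (intro image_eqI[of _ _ "x + int N"]) auto
        then show ?thesis using x by blast
      next
        assume "x \<ge> int (M * b)"
        then have "x \<in> Pr" unfolding Pr_def using xN assms(2) by (intro image_eqI[of _ _ "x - int (M * b)"]) auto
        then show ?thesis using x by blast
      qed
    next
      case False
      define y where "y = x + int (M * b)"
      have y: "0 \<le> y" "y < int (2 * b) * int M" using False by (auto simp: y_def algebra_simps)
      have "y div int M < int (2 * b)" using y assms(1) by (smt (verit) minus_mod_eq_mult_div mult.commute mult_less_cancel_right_disj of_nat_0_less_iff pos_mod_sign)
      moreover have "0 \<le> y div int M" using y assms(1) by (simp add: pos_imp_zdiv_nonneg_iff)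
      moreover have "y = y mod int M + int M * (y div int M)" by simp
      then have "x = (int (nat (y mod int M)) - int (M * b)) + int M * (y div int M)"
        using assms(1) unfolding y_def by simp
      ultimately have "x \<in> P (nat (y mod int M))" unfolding P_def by (intro image_eqI[of _ _ "y div int M"]) auto
      moreover have "nat (y mod int M) < M" using assms(1) by (simp add: nat_less_iff)
      ultimately show ?thesis using x by blast
    qed
  qed
  moreover have "finite (P r)" "finite Pl" "finite Pr" for r by (auto simp: P_def Pl_def Pr_def)
  ultimately have "card A \<le> card ((A \<inter> Pl \<union> A \<inter> Pr) \<union> (\<Union>r<M. A \<inter> P r))" by (intro card_mono) auto
  also have "\<dots> \<le> card (A \<inter> Pl \<union> A \<inter> Pr) + card (\<Union>r<M. A \<inter> P r)" by (rule card_Un_le)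
  also have "card (A \<inter> Pl \<union> A \<inter> Pr) \<le> card (A \<inter> Pl) + card (A \<inter> Pr)" by (rule card_Un_le)
  also have "card (\<Union>r<M. A \<inter> P r) \<le> (\<Sum>r<M. card (A \<inter> P r))" by (intro card_UN_le) auto
  also have "\<dots> = card (A \<inter> P 0) + (\<Sum>r<M - 1. card (A \<inter> P (Suc r)))"
    using sum.lessThan_Suc_shift[of "\<lambda>r. card (A \<inter> P r)" "M - 1"] assms(1) by simp
  finally have cA: "card A \<le> card (A \<inter> Pl) + card (A \<inter> Pr) + (card (A \<inter> P 0) + (\<Sum>r<M - 1. card (A \<inter> P (Suc r))))" by simp
  have AP_P: "real (card (A \<inter> P r)) \<le> \<kappa> * real (2 * b) + \<nu>" for r
    unfolding P_def using assms(1) by (intro AP) auto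
  from cA have "real (card A) \<le> real (card (A \<inter> Pl)) + real (card (A \<inter> Pr)) + (real (card (A \<inter> P 0)) + (\<Sum>r<M - 1. real (card (A \<inter> P (Suc r)))))"
    by (simp flip: of_nat_sum of_nat_add)
  also have "\<dots> \<le> (\<kappa> * real (N - M * b) + \<nu>) + (\<kappa> * real (N - M * b + 1) + \<nu>) + (real (card (A \<inter> P 0)) + (\<Sum>r<M - 1. \<kappa> * real (2 * b) + \<nu>))"
    unfolding Pl_def Pr_def by (intro add_mono sum_mono AP AP_P order_refl) auto
  also have "\<dots> = real (card (A \<inter> P 0)) + \<kappa> * (2 * real (N - M * b) + 1 + real (M - 1) * 2 * b) + real (M - 1 + 2) * \<nu>"
    by (simp add: algebra_simps)
  also have "2 * real (N - M * b) + 1 + real (M - 1) * 2 * b = 2 * N + 1 - 2 * real b"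
    using assms(1,2) by (simp add: of_nat_diff algebra_simps)
  also have "M - 1 + 2 = M + 1" using assms(1) by simp
  finally show ?thesis by (simp add: P_def add.commute)
qed

lemma exists_three:
  assumes "card S \<ge> 3"
  obtains a b g where "a \<in> S" "b \<in> S" "g \<in> S" "a \<noteq> b" "a \<noteq> g" "b \<noteq> g"
proof -
  obtain T where "T \<subseteq> S" "card T = 3" using obtain_subset_with_card_n[OF assms] by blast
  then obtain a b g where "T = {a, b, g}" "a \<noteq> b" "b \<noteq> g" "a \<noteq> g" by (auto simp: card_3_iff)
  then show ?thesis using that[of a b g] \<open>T \<subseteq> S\<close> by simp
qed

text \<open>A largest solution-free set has density at least \<open>\<rho>\<close>, but at most
  \<open>\<rho> + \<eta>\<close> on long progressions. This makes it dense on the multiples of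
  \<open>c a\<close> near \<open>0\<close>, where a cube is found. The values forced by the cube
  then exclude so much of the interval that the rest cannot hold the whole set.\<close>

lemma max_free_density_zero:
  fixes S :: "'i set" and c :: "'i \<Rightarrow> int" and \<rho> :: real
  assumes S: "finite S" "card S \<ge> 3" and c: "\<And>s. s \<in> S \<Longrightarrow> c s \<noteq> 0" and sum0: "sum c S = 0"
    and lower: "\<And>L. \<rho> * real L \<le> max_free S c L"
    and upper: "\<And>\<eta>. \<eta> > 0 \<Longrightarrow> \<exists>n>0. real (max_free S c n) / n \<le> \<rho> + \<eta>"
  shows "\<rho> \<le> 0"
proof (rule ccontr)
  assume "\<not> \<rho> \<le> 0"
  then have \<rho>: "\<rho> > 0" by simp
  have S_ne: "S \<noteq> {}" using S(2) by auto
  have "\<rho> \<le> 1" using lower[of 1] max_free_le[OF S_ne, of c 1] by simp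
  obtain a b g where abg: "a \<in> S" "b \<in> S" "g \<in> S" "a \<noteq> b" "a \<noteq> g" "b \<noteq> g" "c a + c b \<noteq> 0"
  proof -
    obtain a b g where *: "a \<in> S" "b \<in> S" "g \<in> S" "a \<noteq> b" "a \<noteq> g" "b \<noteq> g"
      using exists_three[OF S(2)] by blast
    \<comment> \<open>If all three pair sums vanished, then
      \<open>c a = - c b = c g = - c a\<close>, so \<open>c a\<close> would be
      \<open>0\<close>.\<close>
    have "c a + c b \<noteq> 0 \<or> c a + c g \<noteq> 0 \<or> c b + c g \<noteq> 0" using c[OF *(1)] by linarith
    then show thesis using that[of a b g] that[of a g b] that[of b g a] * by blast
  qed
  define R where "R = S - {a, b, g}"
  define C where "C = nat (\<Sum>s\<in>S. \<bar>c s\<bar>)"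
  have C: "int C = (\<Sum>s\<in>S. \<bar>c s\<bar>)" unfolding C_def by (simp add: sum_nonneg)
  define M where "M = nat \<bar>c a\<bar>"
  have M: "int M = \<bar>c a\<bar>" "M > 0" using c[OF abg(1)] by (auto simp: M_def)
  have "\<bar>c a\<bar> \<le> (\<Sum>s\<in>S. \<bar>c s\<bar>)" using S(1) abg(1) by (intro member_le_sum) auto
  then have "C > 0" using M C by linarith
  have CM: "real (C * M) \<ge> 1" using \<open>C > 0\<close> \<open>M > 0\<close> by (simp add: Suc_leI flip: of_nat_mult)
  \<comment> \<open>About \<open>2 * N / (C * M)\<close> multiples \<open>x\<close> of
    \<open>c a\<close> satisfy \<open>C * \<bar>x\<bar> \<le> N\<close>, and \<open>A\<close> has
    density about \<open>\<rho>\<close> on them. Asking for half of that number leaves room for the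
    errors.\<close>
  define \<omega> where "\<omega> = \<rho> / (C * M)"
  have \<omega>: "\<omega> > 0" using \<rho> CM by (simp add: \<omega>_def)
  \<comment> \<open>The forced values gain \<open>\<rho> * \<omega> * N\<close>. The error from
    \<open>\<eta>\<close> takes a quarter of this, the term with \<open>n / d\<close> at most
    another quarter, and \<open>K2\<close> less than a half.\<close>
  define \<eta> where "\<eta> = \<rho> * \<omega> / 12"
  have \<eta>: "\<eta> > 0" using \<rho> \<omega> by (simp add: \<eta>_def)
  obtain n where n: "n > 0" "real (max_free S c n) / n \<le> \<rho> + \<eta>" using upper[OF \<eta>] by blast
  obtain d :: nat where d: "d > 12 * n / (\<rho> * \<omega>)" using reals_Archimedean2 by blast
  have "12 * n / (\<rho> * \<omega>) > 0" using n \<rho> \<omega> by simp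
  then have d_pos: "d > 0" using d by (intro gr0I) auto
  obtain H N1 where HN: "\<forall>N\<ge>N1. \<forall>W\<subseteq>{- int N..int N}. real (card W) \<ge> \<omega> * N \<longrightarrow>
    (\<exists>Q h. cube_chain d Q h \<and> (\<forall>j<d. h j \<le> int H) \<and> Q d \<subseteq> W)"
    using Hilbert_cube[OF \<omega>, of d] by (elim exE)
  define K1 where "K1 = 2 + (real M + 1) * real n + card S"
  define K2 where "K2 = real n * (real C * (2 * real H)) + real (3 * 2 ^ d + card S)"
  obtain N2 :: nat where N2: "N2 > 2 * K1 / \<omega>" using reals_Archimedean2 by blast
  obtain N3 :: nat where N3: "N3 > 2 * K2 / (\<rho> * \<omega>)" using reals_Archimedean2 by blast
  define N where "N = N1 + N2 + N3 + 1"
  have N: "N \<ge> N1" "real N \<ge> 1" by (auto simp: N_def)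
  have "2 * K1 / \<omega> < N" using N2 by (simp add: N_def)
  then have NK1: "K1 < \<omega> * N / 2" using \<omega> by (simp add: field_simps)
  have "2 * K2 / (\<rho> * \<omega>) < N" using N3 by (simp add: N_def)
  then have NK2: "K2 < \<rho> * \<omega> * N / 2" using \<omega> \<rho> by (simp add: field_simps)
  obtain A' where A': "A' \<subseteq> {0..<int (2 * N + 1)}" "solution_free_int S c A'" "card A' = max_free S c (2 * N + 1)"
    using max_free_attained[OF S_ne] by metis
  define A where "A = {t. int N + 1 * t \<in> A'}"
  have A_free: "solution_free_int S c A" unfolding A_def by (rule solution_free_int_affine[OF A'(2) _ sum0]) simp
  have A_sub: "A \<subseteq> {- int N..int N}" using A'(1) by (auto simp: A_def)
  have "A' = (\<lambda>t. int N + 1 * t) ` A"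
  proof (intro equalityI subsetI)
    fix x assume "x \<in> A'"
    then show "x \<in> (\<lambda>t. int N + 1 * t) ` A" unfolding A_def by (intro image_eqI[of _ _ "x - int N"]) auto
  qed (auto simp: A_def)
  then have "card A' = card A" using card_image[of "\<lambda>t. int N + 1 * t" A] by (simp add: inj_on_def)
  then have A_card: "\<rho> * (2 * real N + 1) \<le> card A" using lower[of "2 * N + 1"] A'(3) by (simp add: add.commute)
  define \<kappa> where "\<kappa> = \<rho> + \<eta>"
  have \<kappa>: "\<kappa> \<ge> 0" using \<rho> \<eta> by (simp add: \<kappa>_def)
  have AP: "real (card (A \<inter> (\<lambda>i. x + e * i) ` {0..<int L})) \<le> \<kappa> * L + n" if "e \<noteq> 0" for e x L
  proof -
    have "real (card (A \<inter> (\<lambda>i. x + e * i) ` {0..<int L})) \<le> max_free S c L"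
      using card_Int_progression_le_max_free[OF A_free that sum0] by simp
    also have "\<dots> \<le> real (max_free S c n) / n * L + n" by (rule max_free_le_linear[OF S_ne sum0 n(1)])
    also have "\<dots> \<le> \<kappa> * L + n" using n(2) by (intro add_right_mono mult_right_mono) (auto simp: \<kappa>_def)
    finally show ?thesis .
  qed
  define q where "q = N div (C * M)"
  have qN: "C * M * q \<le> N" unfolding q_def by simp
  have "N < C * M * (q + 1)" unfolding q_def using \<open>C > 0\<close> \<open>M > 0\<close>
    by (metis dividend_less_times_div mult_pos_pos add.commute mult_Suc_right Suc_eq_plus1)
  then have "real N < real (C * M * (q + 1))" by (subst of_nat_less_iff)
  have q_ge: "\<omega> * N \<le> \<rho> * q + \<rho>"
  proof -
    have "\<omega> * N \<le> \<rho> / (C * M) * (C * M * (q + 1))"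
      unfolding \<omega>_def using \<open>real N < real (C * M * (q + 1))\<close> \<rho> by (intro mult_left_mono) auto
    also have "\<dots> = \<rho> * q + \<rho>" using \<open>C > 0\<close> \<open>M > 0\<close> by (simp add: field_simps)
    finally show ?thesis .
  qed
  have "M * q \<le> C * (M * q)" using \<open>C > 0\<close> by simp
  then have Mq: "M * q \<le> N" using qN unfolding mult.assoc by (rule order_trans)
  define W0 where "W0 = A \<inter> (\<lambda>i. - int (M * q) + int M * i) ` {0..<int (2 * q)}"
  have W0_card: "card W0 \<ge> \<omega> * N + card S"
  proof -
    have "real (card A) \<le> card W0 + \<kappa> * (2 * real N + 1 - 2 * real q) + (real M + 1) * real n"
      unfolding W0_def by (rule card_le_multiples[OF M(2) Mq A_sub]) (rule AP)
    then have "\<rho> * (2 * real N + 1) \<le> card W0 + \<kappa> * (2 * real N + 1 - 2 * real q) + (real M + 1) * real n"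
      using A_card by linarith
    moreover have "\<kappa> * (2 * real N + 1 - 2 * real q) \<le> \<rho> * (2 * real N + 1) - 2 * (\<rho> * q) + \<eta> * (2 * real N + 1)"
      using \<eta> by (simp add: \<kappa>_def algebra_simps)
    moreover have "\<eta> * (2 * real N + 1) \<le> \<omega> * N / 4"
    proof -
      have "\<eta> * (2 * real N + 1) \<le> \<eta> * (3 * real N)" using N \<eta> by (intro mult_left_mono) auto
      also have "\<dots> = \<rho> * (\<omega> * N / 4)" by (simp add: \<eta>_def)
      also have "\<dots> \<le> 1 * (\<omega> * N / 4)" using \<open>\<rho> \<le> 1\<close> \<omega> by (intro mult_right_mono) auto
      finally show ?thesis by simp
    qed
    ultimately have "card W0 \<ge> 2 * (\<rho> * q) - \<omega> * N / 4 - (real M + 1) * real n" by linarith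
    moreover have "\<omega> * N > 0" using \<omega> N by simp
    ultimately show ?thesis using q_ge \<open>\<rho> \<le> 1\<close> NK1 unfolding K1_def by linarith
  qed
  have W0_sub: "W0 \<subseteq> A" by (auto simp: W0_def)
  have finW0: "finite W0" unfolding W0_def by auto
  have W0_mult: "c a dvd x \<and> (\<Sum>s\<in>S. \<bar>c s\<bar>) * \<bar>x\<bar> \<le> int N" if x: "x \<in> W0" for x
  proof -
    obtain i where i: "0 \<le> i" "i < 2 * int q" "x = int M * (i - int q)"
      using x by (auto simp: W0_def algebra_simps)
    have "c a dvd int M" using M by simp
    then have "c a dvd x" using i by simp
    have "\<bar>x\<bar> \<le> int M * int q" using i by (auto simp: abs_mult intro!: mult_left_mono)
    then have "int C * \<bar>x\<bar> \<le> int C * (int M * int q)" by (intro mult_left_mono) auto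
    also have "int C * (int M * int q) = int (C * M * q)" by (simp add: mult.assoc)
    also have "\<dots> \<le> int N" using qN by (subst of_nat_le_iff)
    finally have "int C * \<bar>x\<bar> \<le> int N" .
    with \<open>c a dvd x\<close> show ?thesis using C by simp
  qed
  have "card R \<le> card S" using S(1) by (intro card_mono) (auto simp: R_def)
  moreover have "real (card S) \<le> card W0" using W0_card \<omega> N by (smt (verit) mult_nonneg_nonneg)
  ultimately have "card R \<le> card W0" by simp
  moreover have finR: "finite R" using S(1) by (simp add: R_def)
  ultimately obtain x0 where x0: "x0 ` R \<subseteq> W0" "inj_on x0 R" using card_le_inj[OF finR finW0] by blast
  define W where "W = W0 - x0 ` R"
  have "card W \<ge> card W0 - card (x0 ` R)" unfolding W_def using finR by (intro diff_card_le_card_Diff) auto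
  moreover have "card (x0 ` R) \<le> card S" using card_image_le[OF finR, of x0] \<open>card R \<le> card S\<close> by simp
  ultimately have "card W0 \<le> card W + card S" by linarith
  then have W_card: "\<omega> * N \<le> card W" using W0_card by linarith
  have "W \<subseteq> {- int N..int N}" using W0_sub A_sub by (auto simp: W_def)
  then obtain Q h where Q: "cube_chain d Q h" "\<forall>j<d. h j \<le> int H" "Q d \<subseteq> W"
    using HN N(1) W_card by blast
  have x0': "inj_on x0 (S - {a, b, g})" "x0 ` (S - {a, b, g}) \<subseteq> A"
    and W_disj: "W \<inter> x0 ` (S - {a, b, g}) = {}"
    using x0 W0_sub by (auto simp: R_def W_def)
  have W_sub: "W \<subseteq> A" using W0_sub by (auto simp: W_def)
  have W_mult: "c a dvd x \<and> (\<Sum>s\<in>S. \<bar>c s\<bar>) * \<bar>x\<bar> \<le> int N" if "x \<in> W \<union> x0 ` (S - {a, b, g})" for x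
    using that x0(1) by (intro W0_mult) (auto simp: W_def R_def)
  have Q_le: "h j \<le> int H" if "j < d" for j using Q(2) that by blast
  have "real (card A) \<le> \<kappa> * (2 * real N + 1 - real (card W)) + n * ((2 * real N + 1) / d + (\<Sum>s\<in>S. \<bar>c s\<bar>) * (2 * int H))
           + (3 * 2 ^ d + card S)"
    by (rule card_solution_free_le[where S = S and c = c and a = a and b = b and g = g and A = A and N = N
          and W = W and ?x0.0 = x0 and Q = Q and h = h and d = d and H = H and \<kappa> = \<kappa> and \<nu> = "real n"])
      (fact S(1) abg c A_free A_sub AP x0' W_sub W_disj W_mult Q(1) Q_le Q(3) d_pos \<kappa>)+
  also have "(\<Sum>s\<in>S. \<bar>c s\<bar>) = int C" using C by simp
  finally have "\<rho> * (2 * real N + 1) \<le> \<kappa> * (2 * real N + 1 - real (card W)) + n * ((2 * real N + 1) / d) + K2"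
    using A_card unfolding K2_def by (simp add: distrib_left)
  moreover have "\<kappa> * (2 * real N + 1 - real (card W)) \<le> \<rho> * (2 * real N + 1) - \<rho> * (\<omega> * N) + \<eta> * (3 * real N)"
  proof -
    have "\<kappa> * (2 * real N + 1 - real (card W)) \<le> \<kappa> * (2 * real N + 1 - \<omega> * N)" using W_card \<kappa> by (intro mult_left_mono) auto
    also have "\<dots> = \<rho> * (2 * real N + 1) - \<rho> * (\<omega> * N) + \<eta> * (2 * real N + 1) - \<eta> * (\<omega> * N)"
      by (simp add: \<kappa>_def algebra_simps)
    moreover have "\<eta> * (2 * real N + 1) \<le> \<eta> * (3 * real N)" using N \<eta> by (intro mult_left_mono) auto
    moreover have "\<eta> * (\<omega> * N) \<ge> 0" using \<eta> \<omega> by simp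
    ultimately show ?thesis by linarith
  qed
  moreover have "n * ((2 * real N + 1) / d) \<le> \<rho> * \<omega> * N / 4"
  proof -
    have "12 * n \<le> \<rho> * \<omega> * d" using d \<rho> \<omega> by (simp add: field_simps)
    then have "n / d \<le> \<rho> * \<omega> / 12" using d_pos by (simp add: field_simps)
    then have "n / d * (2 * real N + 1) \<le> \<rho> * \<omega> / 12 * (3 * real N)" using N \<rho> \<omega> by (intro mult_mono) auto
    then show ?thesis by (simp add: mult_ac)
  qed
  moreover have "\<eta> * (3 * real N) = \<rho> * \<omega> * N / 4" by (simp add: \<eta>_def)
  ultimately show False using NK2 by (simp only: mult.assoc)
qed

text \<open>The infimum of the densities \<open>max_free S c L / L\<close> meets both hypotheses of
  \<open>max_free_density_zero\<close>, hence is not positive. So some length \<open>n\<close> has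
  small density, and subadditivity carries this over to all long intervals.\<close>

theorem Roth_translation_invariant:
  fixes S :: "'i set" and c :: "'i \<Rightarrow> int" and \<delta> :: real
  assumes S: "finite S" "card S \<ge> 3" and c: "\<And>s. s \<in> S \<Longrightarrow> c s \<noteq> 0" and sum0: "sum c S = 0"
    and \<delta>: "\<delta> > 0"
  shows "\<exists>L0. \<forall>L\<ge>L0. \<forall>A\<subseteq>{0..<int L}. solution_free_int S c A \<longrightarrow> real (card A) \<le> \<delta> * L"
proof -
  have S_ne: "S \<noteq> {}" using S(2) by auto
  define F where "F = (\<lambda>L. real (max_free S c L) / L) ` {1..}"
  have F: "F \<noteq> {}" "bdd_below F" unfolding F_def by (auto intro!: bdd_belowI[of _ 0])
  have "Inf F \<le> 0"
  proof (rule max_free_density_zero[OF S c sum0])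
    show "Inf F * real L \<le> max_free S c L" for L
    proof (cases "L = 0")
      case False
      then have "Inf F \<le> real (max_free S c L) / L" using F by (intro cInf_lower) (auto simp: F_def)
      then show ?thesis using False by (simp add: field_simps)
    qed simp
    show "\<exists>n>0. real (max_free S c n) / n \<le> Inf F + \<eta>" if "\<eta> > 0" for \<eta>
    proof -
      have "Inf F < Inf F + \<eta>" using that by simp
      from cInf_lessD[OF F(1) this] obtain y where "y \<in> F" "y < Inf F + \<eta>" by blast
      then obtain L where "L \<ge> 1" "y = real (max_free S c L) / L" unfolding F_def by blast
      with \<open>y < Inf F + \<eta>\<close> show ?thesis by (intro exI[of _ L]) simp
    qed
  qed
  then have "Inf F < \<delta> / 2" using \<delta> by simp
  from cInf_lessD[OF F(1) this] obtain y where "y \<in> F" "y < \<delta> / 2" by blast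
  then obtain n where "n \<ge> 1" "y = real (max_free S c n) / n" unfolding F_def by blast
  then have n: "n > 0" "real (max_free S c n) / n < \<delta> / 2" using \<open>y < \<delta> / 2\<close> by auto
  obtain L0 :: nat where L0: "L0 > 2 * n / \<delta>" using reals_Archimedean2 by blast
  have "real (card A) \<le> \<delta> * L" if L: "L \<ge> L0" and A: "A \<subseteq> {0..<int L}" "solution_free_int S c A" for L A
  proof -
    have "2 * n / \<delta> < L" using L0 L by linarith
    then have nL: "real n \<le> \<delta> / 2 * L" using \<delta> by (simp add: field_simps)
    have "real (card A) \<le> max_free S c L" using card_le_max_free[OF A] by simp
    also have "\<dots> \<le> real (max_free S c n) / n * L + n" by (rule max_free_le_linear[OF S_ne sum0 n(1)])
    also have "\<dots> \<le> \<delta> / 2 * L + \<delta> / 2 * L" using n(2) nL by (intro add_mono mult_right_mono) auto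
    finally show ?thesis by simp
  qed
  then show ?thesis by blast
qed

section \<open>The upper bound\<close>

lemma carrier_residue_ring: "carrier (residue_ring n) = {0..<n}"
  by (auto simp: residue_ring_def)

lemma finite_independent_cards:
  assumes "finite (pverts G)"
  shows "finite {card I | I. independent_set G I}"
proof (rule finite_subset)
  show "{card I | I. independent_set G I} \<subseteq> card ` Pow (pverts G)"
    by (auto simp: independent_set_def)
qed (use assms in simp)

lemma card_le_independence_number:
  assumes "finite (pverts G)" "independent_set G I"
  shows "card I \<le> independence_number G"
  unfolding independence_number_def
  by (rule Max_ge[OF finite_independent_cards[OF assms(1)]]) (use assms(2) in blast)

lemma independence_number_attained:
  assumes "finite (pverts G)"
  shows "\<exists>I. independent_set G I \<and> card I = independence_number G"
proof -
  have "independent_set G {}" by (simp add: independent_set_def)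
  then have "{card I | I. independent_set G I} \<noteq> {}" by blast
  from Max_in[OF finite_independent_cards[OF assms] this]
  have "independence_number G \<in> {card I | I. independent_set G I}" unfolding independence_number_def .
  then obtain I where "independence_number G = card I" "independent_set G I" by (elim CollectE exE conjE)
  then show ?thesis by (intro exI[of _ I]) simp
qed

lemma finite_pverts_cayley: "finite (pverts (cayley_digraph p A))"
  by (simp add: cayley_digraph_def carrier_residue_ring)

lemma independent_set_cayley:
  "independent_set (cayley_digraph p A) I \<longleftrightarrow>
     I \<subseteq> {0..<int p} \<and> (\<forall>u\<in>I. \<forall>v\<in>I. u \<noteq> v \<longrightarrow> (v - u) mod int p \<notin> A)"
  unfolding independent_set_def cayley_digraph_def carrier_residue_ring by (auto simp: subset_iff)

text \<open>In-degrees and out-degrees have the same sum, so some vertex has in-degree at most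
  \<open>K\<close>. Put it into \<open>I\<close>, delete it together with its at most
  \<open>2 * K\<close> neighbours, and repeat.\<close>

lemma exists_independent_outdegree:
  assumes "finite V" and "\<And>u. u \<in> V \<Longrightarrow> card {v\<in>V. R u v} \<le> K"
  shows "\<exists>I\<subseteq>V. (\<forall>u\<in>I. \<forall>v\<in>I. u \<noteq> v \<longrightarrow> \<not> R u v) \<and> card V \<le> (2 * K + 1) * card I"
  using assms
proof (induction "card V" arbitrary: V rule: less_induct)
  case (less V)
  show ?case
  proof (cases "V = {}")
    case False
    have "\<exists>v\<in>V. card {u\<in>V. R u v} \<le> K"
    proof (rule ccontr)
      assume "\<not> ?thesis"
      then have "(\<Sum>v\<in>V. K) < (\<Sum>v\<in>V. card {u\<in>V. R u v})"
        using False less.prems(1) by (intro sum_strict_mono) auto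
      also have "\<dots> = (\<Sum>v\<in>V. \<Sum>u\<in>V. if R u v then 1 else 0)"
        using less.prems(1) by (intro sum.cong refl) (simp add: sum.If_cases Int_def)
      also have "\<dots> = (\<Sum>u\<in>V. \<Sum>v\<in>V. if R u v then 1 else 0)" by (rule sum.swap)
      also have "\<dots> = (\<Sum>u\<in>V. card {v\<in>V. R u v})"
        using less.prems(1) by (intro sum.cong refl) (simp add: sum.If_cases Int_def)
      also have "\<dots> \<le> (\<Sum>u\<in>V. K)" by (intro sum_mono less.prems)
      finally show False by simp
    qed
    then obtain v where v: "v \<in> V" "card {u\<in>V. R u v} \<le> K" by blast
    define B where "B = insert v ({u\<in>V. R u v} \<union> {u\<in>V. R v u})"
    have finB: "finite B" using less.prems(1) by (simp add: B_def)
    have "card B \<le> Suc (card ({u\<in>V. R u v} \<union> {u\<in>V. R v u}))" unfolding B_def by (rule card_insert_le_m1) auto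
    also have "\<dots> \<le> Suc (card {u\<in>V. R u v} + card {u\<in>V. R v u})" using card_Un_le by (intro Suc_leI le_imp_less_Suc) blast
    also have "\<dots> \<le> 2 * K + 1" using v less.prems(2)[OF v(1)] by simp
    finally have B: "card B \<le> 2 * K + 1" .
    have BV: "B \<subseteq> V" using v by (auto simp: B_def)
    have "V - B \<subset> V" using v by (auto simp: B_def)
    then have lt: "card (V - B) < card V" using less.prems(1) by (intro psubset_card_mono)
    have deg: "card {w\<in>V - B. R u w} \<le> K" if "u \<in> V - B" for u
    proof -
      have "card {w\<in>V - B. R u w} \<le> card {w\<in>V. R u w}" using less.prems(1) by (intro card_mono) auto
      then show ?thesis using less.prems(2)[of u] that by simp
    qed
    obtain I where I: "I \<subseteq> V - B" "\<forall>u\<in>I. \<forall>w\<in>I. u \<noteq> w \<longrightarrow> \<not> R u w" "card (V - B) \<le> (2 * K + 1) * card I"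
      using less.hyps[OF lt finite_Diff[OF less.prems(1)] deg] by blast
    have finI: "finite I" and vI: "v \<notin> I" using I(1) less.prems(1) finite_subset by (auto simp: B_def)
    have "insert v I \<subseteq> V" using I(1) v by blast
    moreover have "\<forall>u\<in>insert v I. \<forall>w\<in>insert v I. u \<noteq> w \<longrightarrow> \<not> R u w"
      using I(1,2) by (auto simp: B_def)
    moreover have "card V = card (V - B) + card B" using BV finB less.prems(1)
      by (metis card_Diff_subset card_mono le_add_diff_inverse2)
    then have "card V \<le> (2 * K + 1) * card I + (2 * K + 1)" using I(3) B by linarith
    then have "card V \<le> (2 * K + 1) * card (insert v I)" using finI vI by simp
    ultimately show ?thesis by blast
  qed simp
qed

text \<open>On the elements counted here the arcs from \<open>u\<close> to \<open>u + l * z\<close>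
  have out-degree at most \<open>K\<close>, so a proportional part of them is independent. Division
  by \<open>l\<close> modulo \<open>p\<close> turns these arcs into arcs of the Cayley digraph of
  \<open>A\<close>, whose independence number is small.\<close>

lemma card_low_outdegree_le:
  fixes \<epsilon> :: real
  assumes p: "prime p" and A: "A \<subseteq> {0..<int p}" and X: "X \<subseteq> {0..<int p}"
    and indep: "real (independence_number (cayley_digraph p A)) \<le> \<epsilon> * p"
    and l: "\<not> int p dvd l"
  shows "real (card {u\<in>X. card {z\<in>A. (u + l * z) mod int p \<in> X} \<le> K}) \<le> (2 * real K + 1) * (\<epsilon> * p)"
proof -
  define V where "V = {u\<in>X. card {z\<in>A. (u + l * z) mod int p \<in> X} \<le> K}"
  have finA: "finite A" "finite X" using A X finite_subset by blast+
  define R where "R u v \<longleftrightarrow> (\<exists>z\<in>A. v = (u + l * z) mod int p)" for u v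
  have "card {v\<in>V. R u v} \<le> K" if "u \<in> V" for u
  proof -
    have "{v\<in>V. R u v} \<subseteq> (\<lambda>z. (u + l * z) mod int p) ` {z\<in>A. (u + l * z) mod int p \<in> X}"
      by (auto simp: R_def V_def)
    then have "card {v\<in>V. R u v} \<le> card {z\<in>A. (u + l * z) mod int p \<in> X}"
      using finA by (intro surj_card_le) auto
    then show ?thesis using that by (simp add: V_def)
  qed
  moreover have "finite V" using finA by (simp add: V_def)
  ultimately obtain I where I: "I \<subseteq> V" "\<forall>u\<in>I. \<forall>v\<in>I. u \<noteq> v \<longrightarrow> \<not> R u v" "card V \<le> (2 * K + 1) * card I"
    using exists_independent_outdegree[of V R K] by blast
  have Ip: "I \<subseteq> {0..<int p}" using I(1) X by (auto simp: V_def)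
  have p0: "int p > 0" using prime_gt_0_nat[OF p] by simp
  have "coprime l (int p)" using prime_imp_coprime[of "int p" l] p l by (simp add: coprime_commute)
  then obtain m where m: "[l * m = 1] (mod int p)" using cong_solve_coprime_int by blast
  define f where "f u = (m * u) mod int p" for u
  have lf: "[l * f u = u] (mod int p)" for u
  proof -
    have "[l * f u = l * (m * u)] (mod int p)" unfolding f_def by (intro cong_mult cong_refl) (simp add: cong_def)
    also have "l * (m * u) = (l * m) * u" by simp
    also have "[(l * m) * u = 1 * u] (mod int p)" using m by (intro cong_mult cong_refl)
    finally show ?thesis by simp
  qed
  have "inj_on f I"
  proof
    fix u v assume uv: "u \<in> I" "v \<in> I" "f u = f v"
    then have "[u = v] (mod int p)" using lf by (metis cong_sym cong_trans)
    then show "u = v" using uv Ip by (intro cong_less_imp_eq_int[of u "int p" v]) auto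
  qed
  moreover have "independent_set (cayley_digraph p A) (f ` I)"
    unfolding independent_set_cayley
  proof (intro conjI ballI impI)
    show "f ` I \<subseteq> {0..<int p}" using p0 by (auto simp: f_def)
    fix u' v' assume "u' \<in> f ` I" "v' \<in> f ` I" "u' \<noteq> v'"
    then obtain u v where uv: "u \<in> I" "v \<in> I" "u' = f u" "v' = f v" "u \<noteq> v" by blast
    show "(v' - u') mod int p \<notin> A"
    proof
      assume z: "(v' - u') mod int p \<in> A"
      have "[u + l * ((v' - u') mod int p) = u + l * (v' - u')] (mod int p)"
        by (intro cong_add cong_mult cong_refl) (simp add: cong_def)
      also have "u + l * (v' - u') = u + (l * f v - l * f u)" by (simp add: uv algebra_simps)
      also have "[u + (l * f v - l * f u) = u + (v - u)] (mod int p)"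
        by (intro cong_add cong_diff cong_refl lf)
      finally have "(u + l * ((v' - u') mod int p)) mod int p = v mod int p" by (simp add: cong_def)
      also have "\<dots> = v" using uv Ip by auto
      finally have "R u v" unfolding R_def using z by metis
      then show False using I(2) uv by blast
    qed
  qed
  ultimately have "card I \<le> independence_number (cayley_digraph p A)"
    using card_le_independence_number[OF finite_pverts_cayley] by (metis card_image)
  then have "real (card I) \<le> \<epsilon> * p" using indep by linarith
  then have "(2 * real K + 1) * real (card I) \<le> (2 * real K + 1) * (\<epsilon> * p)" by (intro mult_left_mono) auto
  moreover have "real (card V) \<le> real ((2 * K + 1) * card I)" using I(3) by (subst of_nat_le_iff)
  moreover have "real ((2 * K + 1) * card I) = (2 * real K + 1) * real (card I)"
    by (simp add: algebra_simps)
  ultimately show ?thesis unfolding V_def[symmetric] by linarith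
qed

text \<open>
  \<open>F\<close> collects the elements that the rest of a solution already uses, so that the new ones
  have to avoid it.
\<close>

definition extendable :: "nat \<Rightarrow> int set \<Rightarrow> ('i \<Rightarrow> int) \<Rightarrow> nat \<Rightarrow> 'i set \<Rightarrow> int \<Rightarrow> bool" where
  "extendable p A l n T u \<longleftrightarrow> (\<forall>F. finite F \<and> card F + card T \<le> n \<longrightarrow>
     (\<exists>z. inj_on z T \<and> z ` T \<subseteq> A - F \<and> (u + (\<Sum>t\<in>T. l t * z t)) mod int p \<in> A - F - z ` T))"

text \<open>At most \<open>card F\<close> of the available \<open>z\<close> lie in \<open>F\<close>,
  at most \<open>card F\<close> lead into \<open>F\<close>, and at most one leads to
  \<open>z\<close> itself. The last count needs \<open>u \<noteq> 0\<close>: if \<open>l t\<close>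
  is \<open>1\<close> modulo \<open>p\<close>, then from \<open>0\<close> every step leads to its
  own \<open>z\<close>.\<close>

lemma extendable_singleton:
  assumes p: "prime p" and A: "A \<subseteq> {0..<int p}" and l: "\<not> int p dvd l t"
    and u: "u \<in> A - {0}" and deg: "2 * n + 1 < card {z\<in>A. (u + l t * z) mod int p \<in> A - {0}}"
  shows "extendable p A l n {t} u"
  unfolding extendable_def
proof (intro allI impI)
  fix F :: "int set" assume F: "finite F \<and> card F + card {t} \<le> n"
  define Z where "Z = {z\<in>A. (u + l t * z) mod int p \<in> A - {0}}"
  have finZ: "finite Z" unfolding Z_def using A finite_subset by fastforce
  have eqI: "z = z'" if "z \<in> A" "z' \<in> A" "int p dvd (z - z')" for z z'
  proof -
    have "[z = z'] (mod int p)" using that by (simp add: cong_iff_dvd_diff)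
    then show ?thesis using that A by (intro cong_less_imp_eq_int[of z "int p" z']) auto
  qed
  have pp: "prime (int p)" using p by simp
  define B1 where "B1 = {z\<in>Z. (u + l t * z) mod int p \<in> F}"
  define B2 where "B2 = {z\<in>Z. (u + l t * z) mod int p = z}"
  have "inj_on (\<lambda>z. (u + l t * z) mod int p) B1"
  proof
    fix z z' assume z: "z \<in> B1" "z' \<in> B1" "(u + l t * z) mod int p = (u + l t * z') mod int p"
    then have "int p dvd (u + l t * z) - (u + l t * z')" by (simp only: mod_eq_dvd_iff)
    then have "int p dvd l t * (z - z')" by (simp add: algebra_simps)
    then have "int p dvd z - z'" using l pp prime_dvd_mult_iff by blast
    then show "z = z'" using eqI z by (auto simp: B1_def Z_def)
  qed
  then have cB1: "card B1 \<le> card F"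
    by (rule card_inj_on_le) (use F in \<open>auto simp: B1_def\<close>)
  have "z = z'" if z: "z \<in> B2" "z' \<in> B2" for z z'
  proof (rule ccontr)
    assume "z \<noteq> z'"
    have *: "int p dvd u - (1 - l t) * w" if "w \<in> B2" for w
    proof -
      have "w mod int p = w" using that A by (auto simp: B2_def Z_def)
      then have "(u + l t * w) mod int p = w mod int p" using that by (simp add: B2_def)
      then have "int p dvd (u + l t * w) - w" by (simp only: mod_eq_dvd_iff)
      then show ?thesis by (simp add: algebra_simps)
    qed
    have "int p dvd (u - (1 - l t) * z') - (u - (1 - l t) * z)" by (rule dvd_diff[OF *[OF z(2)] *[OF z(1)]])
    then have "int p dvd (1 - l t) * (z - z')" by (simp add: algebra_simps)
    moreover have "\<not> int p dvd z - z'" using eqI[of z z'] z \<open>z \<noteq> z'\<close> by (auto simp: B2_def Z_def)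
    ultimately have "int p dvd 1 - l t" using pp prime_dvd_mult_iff by blast
    then have "int p dvd (u - (1 - l t) * z) + (1 - l t) * z" by (intro dvd_add[OF *[OF z(1)]] dvd_mult2)
    then have "int p dvd u" by simp
    then show False using u A zdvd_not_zless[of u "int p"] by force
  qed
  then have "\<forall>z\<in>B2. \<forall>z'\<in>B2. z = z'" by blast
  moreover have "finite B2" using finZ by (simp add: B2_def)
  ultimately have cB2: "card B2 \<le> 1" using card_le_Suc0_iff_eq[of B2] unfolding One_nat_def by blast
  have "card (F \<union> B1 \<union> B2) \<le> card F + card B1 + card B2" by (meson card_Un_le add_right_mono le_trans)
  also have "\<dots> < card Z" using F cB1 cB2 deg by (simp add: Z_def)
  finally have "\<not> Z \<subseteq> F \<union> B1 \<union> B2" using F finZ card_mono[of "F \<union> B1 \<union> B2" Z] by (auto simp: B1_def B2_def)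
  then obtain z where z: "z \<in> Z" "z \<notin> F" "z \<notin> B1" "z \<notin> B2" by blast
  then show "\<exists>z. inj_on z {t} \<and> z ` {t} \<subseteq> A - F \<and> (u + (\<Sum>t\<in>{t}. l t * z t)) mod int p \<in> A - F - z ` {t}"
    by (intro exI[of _ "\<lambda>_. z"]) (auto simp: Z_def B1_def B2_def)
qed

text \<open>The first step \<open>z\<close> joins the forbidden set before the rest of the path is
  chosen. \<open>F\<close> grows by one element while one index is used up, so the budget
  \<open>n\<close> still suffices.\<close>

lemma extendable_insert:
  assumes T: "finite T" "t \<notin> T" and A: "finite A"
    and deg: "n < card {z\<in>A. extendable p A l n T ((u + l t * z) mod int p)}"
  shows "extendable p A l n (insert t T) u"
  unfolding extendable_def
proof (intro allI impI)
  fix F :: "int set" assume F: "finite F \<and> card F + card (insert t T) \<le> n"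
  have "\<not> {z\<in>A. extendable p A l n T ((u + l t * z) mod int p)} \<subseteq> F"
  proof
    assume "{z\<in>A. extendable p A l n T ((u + l t * z) mod int p)} \<subseteq> F"
    then have "card {z\<in>A. extendable p A l n T ((u + l t * z) mod int p)} \<le> card F" using F by (intro card_mono) auto
    then show False using deg F by linarith
  qed
  then obtain z where z: "z \<in> A" "z \<notin> F" "extendable p A l n T ((u + l t * z) mod int p)" by blast
  have "finite (insert z F) \<and> card (insert z F) + card T \<le> n" using F T z(2) by simp
  then obtain y where y: "inj_on y T" "y ` T \<subseteq> A - insert z F"
    "((u + l t * z) mod int p + (\<Sum>t\<in>T. l t * y t)) mod int p \<in> A - insert z F - y ` T"
    using z(3) unfolding extendable_def by blast
  define x where "x = y(t := z)"
  have xT: "x s = y s" if "s \<in> T" for s using that T by (auto simp: x_def)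
  have img: "x ` T = y ` T" using xT by simp
  have xt: "x t = z" by (simp add: x_def)
  have "(\<Sum>s\<in>insert t T. l s * x s) = l t * z + (\<Sum>s\<in>T. l s * y s)" using T xT by (simp add: xt)
  then have "(u + (\<Sum>s\<in>insert t T. l s * x s)) mod int p = ((u + l t * z) mod int p + (\<Sum>t\<in>T. l t * y t)) mod int p"
    by (simp add: mod_add_left_eq add.assoc)
  moreover have "inj_on x (insert t T)"
  proof -
    have "inj_on x T" using y(1) inj_on_cong[of T x y] xT by blast
    moreover have "z \<notin> y ` T" using y(2) by blast
    ultimately show ?thesis unfolding inj_on_insert using T(2) xt img by simp
  qed
  moreover have "x ` insert t T \<subseteq> A - F" using y(2) z img xt by auto
  ultimately show "\<exists>z. inj_on z (insert t T) \<and> z ` insert t T \<subseteq> A - F \<and>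
      (u + (\<Sum>t\<in>insert t T. l t * z t)) mod int p \<in> A - F - z ` insert t T"
    using y(3) img xt by (intro exI[of _ x]) auto
qed

text \<open>Each index costs one application of \<open>card_low_outdegree_le\<close> with
  \<open>K = 2 * n + 1\<close>, whence \<open>4 * n + 3\<close>. The steps for a new index are
  required to end in the set \<open>X\<close> of elements from which the path for the remaining
  indices already exists.\<close>

lemma card_not_extendable_le:
  fixes \<epsilon> :: real
  assumes p: "prime p" and A: "A \<subseteq> {0..<int p}"
    and indep: "real (independence_number (cayley_digraph p A)) \<le> \<epsilon> * p"
    and T: "finite T" "T \<noteq> {}" and l: "\<And>t. t \<in> T \<Longrightarrow> \<not> int p dvd l t"
  shows "real (card {u\<in>A - {0}. \<not> extendable p A l n T u}) \<le> card T * ((4 * real n + 3) * (\<epsilon> * p))"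
  using T l
proof (induction rule: finite_ne_induct)
  case (singleton t)
  have finA: "finite A" using A finite_subset by blast
  have "{u\<in>A - {0}. \<not> extendable p A l n {t} u} \<subseteq>
      {u\<in>A - {0}. card {z\<in>A. (u + l t * z) mod int p \<in> A - {0}} \<le> 2 * n + 1}"
    using extendable_singleton[OF p A, of l t] singleton by (auto simp: not_le[symmetric])
  then have "card {u\<in>A - {0}. \<not> extendable p A l n {t} u} \<le>
      card {u\<in>A - {0}. card {z\<in>A. (u + l t * z) mod int p \<in> A - {0}} \<le> 2 * n + 1}"
    using finA by (intro card_mono) auto
  moreover have "real (card {u\<in>A - {0}. card {z\<in>A. (u + l t * z) mod int p \<in> A - {0}} \<le> 2 * n + 1})
      \<le> (2 * real (2 * n + 1) + 1) * (\<epsilon> * p)"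
    using singleton A by (intro card_low_outdegree_le[OF p A _ indep]) auto
  moreover have "(2 * real (2 * n + 1) + 1) * (\<epsilon> * p) = card {t} * ((4 * real n + 3) * (\<epsilon> * p))"
    by (simp add: algebra_simps)
  ultimately show ?case by linarith
next
  case (insert t T)
  have finA: "finite A" using A finite_subset by blast
  define X where "X = {u\<in>A - {0}. extendable p A l n T u}"
  define L where "L = {u\<in>X. card {z\<in>A. (u + l t * z) mod int p \<in> X} \<le> 2 * n + 1}"
  have "extendable p A l n (insert t T) u" if "u \<in> X" "u \<notin> L" for u
  proof (rule extendable_insert[OF insert.hyps(1,3) finA])
    have "n < card {z\<in>A. (u + l t * z) mod int p \<in> X}" using that by (simp add: L_def)
    also have "\<dots> \<le> card {z\<in>A. extendable p A l n T ((u + l t * z) mod int p)}"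
      using finA by (intro card_mono) (auto simp: X_def)
    finally show "n < card {z\<in>A. extendable p A l n T ((u + l t * z) mod int p)}" .
  qed
  then have "{u\<in>A - {0}. \<not> extendable p A l n (insert t T) u} \<subseteq> {u\<in>A - {0}. \<not> extendable p A l n T u} \<union> L"
    by (auto simp: X_def)
  then have "card {u\<in>A - {0}. \<not> extendable p A l n (insert t T) u} \<le> card ({u\<in>A - {0}. \<not> extendable p A l n T u} \<union> L)"
    using finA by (intro card_mono) (auto simp: L_def X_def)
  also have "\<dots> \<le> card {u\<in>A - {0}. \<not> extendable p A l n T u} + card L" by (rule card_Un_le)
  finally have "real (card {u\<in>A - {0}. \<not> extendable p A l n (insert t T) u}) \<le>
      real (card {u\<in>A - {0}. \<not> extendable p A l n T u}) + real (card L)" by simp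
  also have "\<dots> \<le> card T * ((4 * real n + 3) * (\<epsilon> * p)) + (2 * real (2 * n + 1) + 1) * (\<epsilon> * p)"
    unfolding L_def using A insert by (intro add_mono card_low_outdegree_le[OF p A _ indep]) (auto simp: X_def)
  also have "\<dots> = card (insert t T) * ((4 * real n + 3) * (\<epsilon> * p))"
    using insert.hyps by (simp add: algebra_simps)
  finally show ?case .
qed

text \<open>An element \<open>u\<close> outside \<open>{0} \<union> U \<union> N\<close> starts both
  a zero sum over \<open>S\<close> and a path that avoids the other members of this sum. The end of
  the path replaces \<open>u\<close>, so \<open>u\<close> itself is not claimed as a value of the
  solution and may be reused.\<close>

lemma solution_free_card_le:
  fixes \<epsilon> :: real
  assumes p: "prime p" and A: "A \<subseteq> {0..<int p}" "solution_free k c p A"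
    and indep: "real (independence_number (cayley_digraph p A)) \<le> \<epsilon> * p"
    and c: "\<And>i. i \<in> {1..k} \<Longrightarrow> \<not> int p dvd c i"
    and S: "S \<subseteq> {1..k}" "S \<noteq> {}" "sum c S = 0" "S \<noteq> {1..k}"
    and Roth: "\<And>B. card S \<ge> 3 \<Longrightarrow> B \<subseteq> {0..<int p} \<Longrightarrow> solution_free_int S c B \<Longrightarrow> real (card B) \<le> \<epsilon> * p"
    and \<epsilon>: "\<epsilon> > 0"
  shows "real (card A) \<le> 1 + (1 + k * (4 * real k + 3)) * (\<epsilon> * p)"
proof (rule ccontr)
  assume big: "\<not> ?thesis"
  have finA: "finite A" using A finite_subset by blast
  have finS: "finite S" using S finite_subset by blast
  obtain s where s: "s \<in> S" using S by blast
  define S' where "S' = S - {s}"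
  define T where "T = {1..k} - S"
  have finT: "finite T" "T \<noteq> {}" using S by (auto simp: T_def)
  have cs: "\<not> int p dvd c s" using s S c by blast
  then have "coprime (c s) (int p)" using prime_imp_coprime[of "int p" "c s"] p by (simp add: coprime_commute)
  then obtain m where m: "[c s * m = 1] (mod int p)" using cong_solve_coprime_int by blast
  have pp: "prime (int p)" using p by simp
  have mp: "\<not> int p dvd m"
  proof
    assume "int p dvd m"
    then have "int p dvd c s * m" by (rule dvd_mult)
    then have "int p dvd 1" using m by (simp add: cong_def dvd_eq_mod_eq_0)
    then show False using pp not_prime_unit by blast
  qed
  \<comment> \<open>\<open>m\<close> inverts \<open>c s\<close> modulo \<open>p\<close>, so in
    \<open>c s * (u + l t * z)\<close> the step contributes \<open>- c t * z\<close>, which cancels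
    the term of index \<open>t\<close>.\<close>
  define l where "l t = - (c t * m)" for t
  have l: "\<not> int p dvd l t" if "t \<in> T" for t
    using c[of t] mp that pp by (auto simp: l_def T_def prime_dvd_mult_iff)
  define U where "U = {u\<in>A. \<not> (\<exists>x. inj_on x S' \<and> x ` S' \<subseteq> A \<and> c s * u + (\<Sum>i\<in>S'. c i * x i) = 0)}"
  have cU: "real (card U) \<le> \<epsilon> * p"
  proof (cases "card S \<ge> 3")
    case True
    have "solution_free_int S c U" unfolding solution_free_int_def
    proof
      assume "\<exists>x. inj_on x S \<and> x ` S \<subseteq> U \<and> (\<Sum>s\<in>S. c s * x s) = 0"
      then obtain x where x: "inj_on x S" "x ` S \<subseteq> U" "(\<Sum>s\<in>S. c s * x s) = 0" by blast
      have "(\<Sum>s\<in>S. c s * x s) = c s * x s + (\<Sum>i\<in>S'. c i * x i)" unfolding S'_def using finS s by (rule sum.remove)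
      moreover have "inj_on x S'" using x(1) by (rule inj_on_subset) (auto simp: S'_def)
      moreover have "x ` S' \<subseteq> A" "x s \<in> U" using x(2) s by (auto simp: S'_def U_def)
      ultimately show False using x(3) unfolding U_def by auto
    qed
    moreover have "U \<subseteq> {0..<int p}" using A by (auto simp: U_def)
    ultimately show ?thesis using Roth True by blast
  next
    case False
    have "card S \<noteq> 1"
    proof
      assume "card S = 1"
      then obtain i where "S = {i}" using card_1_singletonE by blast
      then show False using S(3) cs s by simp
    qed
    moreover have "card S \<noteq> 0" using S finS by simp
    ultimately have "card S = 2" using False by linarith
    then have "card S' = 1" using s finS by (simp add: S'_def)
    then obtain i where i: "S' = {i}" using card_1_singletonE by blast
    then have "S = {s, i}" "s \<noteq> i" using s by (auto simp: S'_def)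
    then have "c s + c i = 0" using S(3) by simp
    then have sum0: "c s * u + c i * u = 0" for u by (metis distrib_right mult_zero_left)
    \<comment> \<open>With two opposite coefficients \<open>u\<close> itself serves as the other
      variable; no clash arises, since \<open>u\<close> is later replaced by the end of the
      path.\<close>
    have "u \<notin> U" if "u \<in> A" for u
    proof -
      have "inj_on (\<lambda>_. u) S' \<and> (\<lambda>_. u) ` S' \<subseteq> A \<and> c s * u + (\<Sum>i\<in>S'. c i * u) = 0"
        using that sum0 by (simp add: i)
      then show ?thesis unfolding U_def by blast
    qed
    then have "U = {}" by (auto simp: U_def)
    then show ?thesis using \<epsilon> by simp
  qed
  define N where "N = {u\<in>A - {0}. \<not> extendable p A l k T u}"
  have cN: "real (card N) \<le> card T * ((4 * real k + 3) * (\<epsilon> * p))"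
    unfolding N_def by (rule card_not_extendable_le[OF p A(1) indep finT l])
  have "card T \<le> k" using card_mono[of "{1..k}" T] by (auto simp: T_def)
  then have "card T * ((4 * real k + 3) * (\<epsilon> * p)) \<le> k * ((4 * real k + 3) * (\<epsilon> * p))"
    using \<epsilon> by (intro mult_right_mono) auto
  with cN have cN: "real (card N) \<le> k * ((4 * real k + 3) * (\<epsilon> * p))" by linarith
  have "card ({0} \<union> U \<union> N) \<le> card {0::int} + card U + card N" by (meson card_Un_le add_right_mono le_trans)
  then have "real (card ({0} \<union> U \<union> N)) \<le> 1 + real (card U) + real (card N)" by simp
  also have "\<dots> \<le> 1 + \<epsilon> * p + k * ((4 * real k + 3) * (\<epsilon> * p))" using cU cN by simp
  also have "\<dots> < card A" using big by (simp add: algebra_simps)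
  finally have "card ({0} \<union> U \<union> N) < card A" by simp
  moreover have "finite ({0} \<union> U \<union> N)" using finA by (auto simp: U_def N_def)
  ultimately have "\<not> A \<subseteq> {0} \<union> U \<union> N" using card_mono[of "{0} \<union> U \<union> N" A] by linarith
  then obtain u where u: "u \<in> A" "u \<noteq> 0" "u \<notin> U" "u \<notin> N" by blast
  obtain x where x: "inj_on x S'" "x ` S' \<subseteq> A" "c s * u + (\<Sum>i\<in>S'. c i * x i) = 0" using u by (auto simp: U_def)
  have ext: "extendable p A l k T u" using u by (auto simp: N_def)
  have finS': "finite S'" using finS by (simp add: S'_def)
  have "card (x ` S') \<le> card S" using card_image_le[OF finS', of x] card_mono[OF finS, of S'] by (auto simp: S'_def)
  moreover have "card S + card T = k" unfolding T_def
    using card_Diff_subset[OF finS S(1)] card_mono[OF _ S(1)] by simp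
  ultimately have "finite (x ` S') \<and> card (x ` S') + card T \<le> k" using finS' by simp
  then obtain z where z: "inj_on z T" "z ` T \<subseteq> A - x ` S'" "(u + (\<Sum>t\<in>T. l t * z t)) mod int p \<in> A - x ` S' - z ` T"
    using ext unfolding extendable_def by blast
  define v where "v = (u + (\<Sum>t\<in>T. l t * z t)) mod int p"
  define a where "a i = (if i = s then v else if i \<in> S' then x i else z i)" for i
  have as: "a s = v" by (simp add: a_def)
  have aS: "a i = x i" if "i \<in> S'" for i using that by (auto simp: a_def S'_def)
  have aT: "a i = z i" if "i \<in> T" for i using that s by (auto simp: a_def T_def S'_def)
  have K: "{1..k} = insert s (S' \<union> T)" and disj: "s \<notin> S' \<union> T" "S' \<inter> T = {}"
    using S(1) s by (auto simp: S'_def T_def)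
  have imgS: "a ` S' = x ` S'" and imgT: "a ` T = z ` T" using aS aT by auto
  have "inj_on a S'" "inj_on a T" using inj_on_cong[of S' a x] inj_on_cong[of T a z] aS aT x(1) z(1) by blast+
  moreover have "a ` S' \<inter> a ` T = {}" unfolding imgS imgT using z(2) by blast
  ultimately have "inj_on a (S' \<union> T)" using disj(2) by (subst inj_on_Un) (auto simp: Diff_triv Int_commute)
  moreover have "v \<notin> a ` (S' \<union> T)" using z(3) unfolding image_Un imgS imgT v_def by blast
  ultimately have inj: "inj_on a {1..k}" unfolding K inj_on_insert using disj as by simp
  have sub: "a ` {1..k} \<subseteq> A" unfolding K image_insert image_Un imgS imgT as using z x by (auto simp: v_def)
  have "(\<Sum>i=1..k. c i * a i) = c s * v + ((\<Sum>i\<in>S'. c i * x i) + (\<Sum>t\<in>T. c t * z t))"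
    unfolding K using disj finT finS' by (simp add: sum.union_disjoint as aS aT)
  also have "[\<dots> = c s * (u + (\<Sum>t\<in>T. l t * z t)) + ((\<Sum>i\<in>S'. c i * x i) + (\<Sum>t\<in>T. c t * z t))] (mod int p)"
    unfolding v_def by (intro cong_add cong_mult cong_refl) (simp add: cong_def)
  also have "c s * (u + (\<Sum>t\<in>T. l t * z t)) + ((\<Sum>i\<in>S'. c i * x i) + (\<Sum>t\<in>T. c t * z t))
      = (c s * u + (\<Sum>i\<in>S'. c i * x i)) + (1 - c s * m) * (\<Sum>t\<in>T. c t * z t)"
  proof -
    have "(\<Sum>t\<in>T. l t * z t) = - (m * (\<Sum>t\<in>T. c t * z t))"
      by (simp add: l_def sum_distrib_left sum_negf mult_ac)
    then show ?thesis by (simp add: algebra_simps)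
  qed
  also have "\<dots> = (1 - c s * m) * (\<Sum>t\<in>T. c t * z t)" using x(3) by simp
  also have "[\<dots> = (1 - 1) * (\<Sum>t\<in>T. c t * z t)] (mod int p)" by (intro cong_mult cong_diff cong_refl m)
  finally have "[(\<Sum>i=1..k. c i * a i) = 0] (mod int p)" by simp
  then show False using A(2) inj sub unfolding solution_free_def by blast
qed

section \<open>Concentration in the Hamming cube\<close>

text \<open>
  The case \<open>d = 1\<close> of the two-function form of Talagrand's inequality for the Hamming distance, which
  tensorises.
\<close>

lemma sum_mult_sum_le:
  fixes f g :: "'a \<Rightarrow> real" and T \<kappa> :: real
  assumes fin: "finite \<Omega>" and \<pi>: "bij_betw \<pi> \<Omega> \<Omega>"
    and nonneg: "\<And>x. x \<in> \<Omega> \<Longrightarrow> f x \<ge> 0" "\<And>x. x \<in> \<Omega> \<Longrightarrow> g x \<ge> 0"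
    and T: "T \<ge> 1" and \<kappa>: "\<kappa> > 0"
    and all: "\<And>x y. x \<in> \<Omega> \<Longrightarrow> y \<in> \<Omega> \<Longrightarrow> f x * g y \<le> \<kappa> * T"
    and diag: "\<And>x. x \<in> \<Omega> \<Longrightarrow> f x * g (\<pi> x) \<le> \<kappa>"
  shows "sum f \<Omega> * sum g \<Omega> \<le> \<kappa> * ((real (card \<Omega>))\<^sup>2 * (T * (1 + 1 / T)\<^sup>2 / 4))"
proof (cases "\<forall>x\<in>\<Omega>. f x = 0")
  case True
  then show ?thesis using \<kappa> T by simp
next
  case False
  define M where "M = Max (f ` \<Omega>)"
  have fM: "f x \<le> M" if "x \<in> \<Omega>" for x unfolding M_def using fin that by (intro Max_ge) auto
  obtain x0 where x0: "x0 \<in> \<Omega>" "f x0 \<noteq> 0" using False by blast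
  then have M: "M > 0" using fM[OF x0(1)] nonneg(1)[OF x0(1)] by linarith
  have "M \<in> f ` \<Omega>" unfolding M_def using fin x0 by (intro Max_in) auto
  then obtain x1 where x1: "x1 \<in> \<Omega>" "f x1 = M" by blast
  define a where "a x = f x / M" for x
  define b where "b x = g (\<pi> x) * M / (\<kappa> * T)" for x
  have \<pi>\<Omega>: "\<pi> x \<in> \<Omega>" if "x \<in> \<Omega>" for x using \<pi> that by (auto simp: bij_betw_def)
  \<comment> \<open>After the normalisation both factors are at most \<open>1\<close>, so
    \<open>(1 - a x) * (1 - b x) \<ge> 0\<close> turns the diagonal bound on the product into a
    bound on the sum. Summation and the inequality of the means then bound the product of the
    sums.\<close>
  have ab: "a x + b x \<le> 1 + 1 / T" if x: "x \<in> \<Omega>" for x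
  proof -
    have a1: "a x \<le> 1" using fM[OF x] M by (simp add: a_def)
    have "M * g (\<pi> x) \<le> \<kappa> * T" using all[OF x1(1) \<pi>\<Omega>[OF x]] x1 by simp
    then have b1: "b x \<le> 1" using \<kappa> T by (simp add: b_def mult.commute)
    have "a x * b x = f x * g (\<pi> x) / (\<kappa> * T)" using M by (simp add: a_def b_def)
    also have "\<dots> \<le> \<kappa> / (\<kappa> * T)" using diag[OF x] \<kappa> T by (intro divide_right_mono) auto
    also have "\<dots> = 1 / T" using \<kappa> by simp
    finally have "a x * b x \<le> 1 / T" .
    moreover have "(1 - a x) * (1 - b x) \<ge> 0" using a1 b1 by simp
    ultimately show ?thesis by (simp add: algebra_simps)
  qed
  define u where "u = sum a \<Omega>"
  define v where "v = sum b \<Omega>"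
  have uv0: "u \<ge> 0" "v \<ge> 0" unfolding u_def v_def a_def b_def
    using nonneg M \<kappa> T \<pi>\<Omega> by (auto intro!: sum_nonneg)
  have "u + v = (\<Sum>x\<in>\<Omega>. a x + b x)" by (simp add: u_def v_def sum.distrib)
  also have "\<dots> \<le> (\<Sum>x\<in>\<Omega>. 1 + 1 / T)" by (intro sum_mono ab)
  finally have uv: "u + v \<le> card \<Omega> * (1 + 1 / T)" by simp
  have "u * v \<le> ((u + v) / 2)\<^sup>2" using sum_squares_bound[of u v] by (simp add: power2_eq_square field_simps)
  also have "\<dots> \<le> (card \<Omega> * (1 + 1 / T) / 2)\<^sup>2" using uv uv0 by (intro power_mono divide_right_mono) auto
  finally have uv_le: "u * v \<le> (card \<Omega> * (1 + 1 / T) / 2)\<^sup>2" .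
  have fu: "sum f \<Omega> = M * u" using M by (simp add: u_def a_def sum_distrib_left)
  have "sum g \<Omega> = (\<Sum>x\<in>\<Omega>. g (\<pi> x))" by (rule sum.reindex_bij_betw[OF \<pi>, symmetric])
  also have "\<dots> = \<kappa> * T / M * v" using M \<kappa> T by (simp add: v_def b_def sum_distrib_left)
  finally have "sum f \<Omega> * sum g \<Omega> = \<kappa> * T * (u * v)" using M by (simp add: fu)
  also have "\<dots> \<le> \<kappa> * T * (card \<Omega> * (1 + 1 / T) / 2)\<^sup>2" using uv_le \<kappa> T by (intro mult_left_mono) auto
  finally show ?thesis by (simp add: power_mult_distrib power_divide mult_ac)
qed

definition words :: "'a set \<Rightarrow> nat \<Rightarrow> 'a list set" where
  "words \<Omega> d = {xs. set xs \<subseteq> \<Omega> \<and> length xs = d}"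

text \<open>For words of equal length this is the Hamming distance from \<open>map \<pi> xs\<close>
  to \<open>ys\<close>.\<close>

definition mismatches :: "('a \<Rightarrow> 'a) \<Rightarrow> 'a list \<Rightarrow> 'a list \<Rightarrow> nat" where
  "mismatches \<pi> xs ys = length (filter (\<lambda>(x, y). y \<noteq> \<pi> x) (zip xs ys))"

lemma sum_words_Suc:
  assumes "finite \<Omega>"
  shows "sum f (words \<Omega> (Suc d)) = (\<Sum>x\<in>\<Omega>. \<Sum>xs\<in>words \<Omega> d. f (x # xs))"
proof -
  have "words \<Omega> (Suc d) = (\<lambda>(x, xs). x # xs) ` (\<Omega> \<times> words \<Omega> d)"
    by (auto simp: words_def length_Suc_conv)
  moreover have "inj_on (\<lambda>(x, xs). x # xs) (\<Omega> \<times> words \<Omega> d)" by (auto simp: inj_on_def)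
  ultimately have "sum f (words \<Omega> (Suc d)) = (\<Sum>(x, xs)\<in>\<Omega> \<times> words \<Omega> d. f (x # xs))"
    by (simp add: sum.reindex case_prod_unfold)
  also have "\<dots> = (\<Sum>x\<in>\<Omega>. \<Sum>xs\<in>words \<Omega> d. f (x # xs))" by (rule sum.cartesian_product[symmetric])
  finally show ?thesis .
qed

lemma finite_words: "finite \<Omega> \<Longrightarrow> finite (words \<Omega> d)"
  unfolding words_def by (rule finite_lists_length_eq)

lemma card_words: "finite \<Omega> \<Longrightarrow> card (words \<Omega> d) = card \<Omega> ^ d"
  unfolding words_def by (rule card_lists_length_eq)

text \<open>Tensorisation: for fixed first letters \<open>x\<close> and \<open>y\<close> the
  induction hypothesis bounds the product of the partial sums, with an extra factor \<open>T\<close>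
  exactly if \<open>y \<noteq> \<pi> x\<close>. These bounds are the hypotheses of the one-letter
  case.\<close>

lemma sum_mult_sum_words_le:
  fixes f g :: "'a list \<Rightarrow> real" and T \<kappa> :: real
  assumes fin: "finite \<Omega>" "\<Omega> \<noteq> {}" and \<pi>: "bij_betw \<pi> \<Omega> \<Omega>" and T: "T \<ge> 1" and \<kappa>: "\<kappa> > 0"
    and nonneg: "\<And>xs. f xs \<ge> 0" "\<And>xs. g xs \<ge> 0"
    and le: "\<And>xs ys. xs \<in> words \<Omega> d \<Longrightarrow> ys \<in> words \<Omega> d \<Longrightarrow> f xs * g ys \<le> \<kappa> * T ^ mismatches \<pi> xs ys"
  shows "sum f (words \<Omega> d) * sum g (words \<Omega> d) \<le> \<kappa> * ((real (card \<Omega>))\<^sup>2 * (T * (1 + 1 / T)\<^sup>2 / 4)) ^ d"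
  using \<kappa> nonneg le
proof (induction d arbitrary: f g \<kappa>)
  case 0
  have w: "words \<Omega> 0 = {[]}" by (auto simp: words_def)
  show ?case using 0(4)[of "[]" "[]"] by (simp add: w mismatches_def)
next
  case (Suc d)
  define K where "K = (real (card \<Omega>))\<^sup>2 * (T * (1 + 1 / T)\<^sup>2 / 4)"
  have "card \<Omega> > 0" using fin by (simp add: card_gt_0_iff)
  then have K: "K > 0" unfolding K_def using T by (intro mult_pos_pos divide_pos_pos zero_less_power) (auto intro: add_pos_nonneg)
  define F where "F x = (\<Sum>xs\<in>words \<Omega> d. f (x # xs))" for x
  define G where "G x = (\<Sum>xs\<in>words \<Omega> d. g (x # xs))" for x
  have FG: "F x * G y \<le> (\<kappa> * K ^ d) * (if y = \<pi> x then 1 else T)" if "x \<in> \<Omega>" "y \<in> \<Omega>" for x y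
  proof -
    have "F x * G y \<le> (\<kappa> * (if y = \<pi> x then 1 else T)) * K ^ d"
      unfolding F_def G_def K_def
    proof (rule Suc.IH)
      show "\<kappa> * (if y = \<pi> x then 1 else T) > 0" using Suc.prems(1) T by simp
      fix xs ys assume "xs \<in> words \<Omega> d" "ys \<in> words \<Omega> d"
      then have "x # xs \<in> words \<Omega> (Suc d)" "y # ys \<in> words \<Omega> (Suc d)" using that by (auto simp: words_def)
      from Suc.prems(4)[OF this]
      show "f (x # xs) * g (y # ys) \<le> \<kappa> * (if y = \<pi> x then 1 else T) * T ^ mismatches \<pi> xs ys"
        by (auto simp: mismatches_def)
    qed (use Suc.prems in auto)
    then show ?thesis by (simp add: mult_ac)
  qed
  have "sum F \<Omega> * sum G \<Omega> \<le> (\<kappa> * K ^ d) * ((real (card \<Omega>))\<^sup>2 * (T * (1 + 1 / T)\<^sup>2 / 4))"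
  proof (rule sum_mult_sum_le[OF fin(1) \<pi>])
    show "F x * G y \<le> \<kappa> * K ^ d * T" if "x \<in> \<Omega>" "y \<in> \<Omega>" for x y
    proof -
      have "\<kappa> * K ^ d * (if y = \<pi> x then 1 else T) \<le> \<kappa> * K ^ d * T"
        using Suc.prems(1) K T by (intro mult_left_mono) auto
      then show ?thesis using FG[OF that] by linarith
    qed
    show "F x * G (\<pi> x) \<le> \<kappa> * K ^ d" if "x \<in> \<Omega>" for x
      using FG[OF that, of "\<pi> x"] \<pi> that by (auto simp: bij_betw_def)
  qed (use Suc.prems K T in \<open>auto simp: F_def G_def intro!: sum_nonneg\<close>)
  also have "\<dots> = \<kappa> * K ^ Suc d" by (simp add: K_def)
  finally show ?case by (simp add: sum_words_Suc[OF fin(1)] F_def G_def K_def)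
qed

text \<open>The left side is the square of \<open>cosh (t / 2)\<close>. In the quadratic upper
  bounds for \<open>exp t\<close> and \<open>exp (- t)\<close> the linear terms cancel.\<close>

lemma cosh_type_bound:
  fixes t :: real
  assumes "0 \<le> t" "t \<le> 1"
  shows "exp t * (1 + 1 / exp t)\<^sup>2 / 4 \<le> exp (t\<^sup>2 / 2)"
proof -
  have "exp t \<le> 1 + t + t\<^sup>2" using assms by (rule exp_bound)
  moreover have "1 / exp t \<le> 1 - t + t\<^sup>2"
  proof -
    have "1 / exp t \<le> 1 / (1 + t)" using assms exp_ge_add_one_self[of t] by (intro divide_left_mono) auto
    also have "\<dots> \<le> 1 - t + t\<^sup>2"
    proof -
      have "(1 - t + t\<^sup>2) * (1 + t) = 1 + t ^ 3" by (simp add: algebra_simps power2_eq_square power3_eq_cube)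
      then have "1 \<le> (1 - t + t\<^sup>2) * (1 + t)" using assms by simp
      then show ?thesis using assms by (simp add: divide_le_eq)
    qed
    finally show ?thesis .
  qed
  moreover have "exp t * (1 + 1 / exp t)\<^sup>2 = exp t + 2 + 1 / exp t"
    by (simp add: power2_eq_square field_simps)
  ultimately have "exp t * (1 + 1 / exp t)\<^sup>2 / 4 \<le> 1 + t\<^sup>2 / 2" by simp
  also have "\<dots> \<le> exp (t\<^sup>2 / 2)" by (rule exp_ge_add_one_self)
  finally show ?thesis .
qed

text \<open>Both functions are the indicator of \<open>X\<close>. For \<open>T = exp \<tau>\<close>
  the distance hypothesis permits \<open>\<kappa> = exp (- (\<tau>\<^sup>2 * d))\<close>, while the
  tensorised factor gives back only \<open>exp (\<tau>\<^sup>2 * d / 2)\<close>.\<close>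

lemma words_concentration:
  fixes \<tau> :: real
  assumes fin: "finite \<Omega>" "\<Omega> \<noteq> {}" and \<pi>: "bij_betw \<pi> \<Omega> \<Omega>" and \<tau>: "0 \<le> \<tau>" "\<tau> \<le> 1"
    and X: "X \<subseteq> words \<Omega> d" and far: "\<And>xs ys. xs \<in> X \<Longrightarrow> ys \<in> X \<Longrightarrow> real (mismatches \<pi> xs ys) > \<tau> * d"
  shows "(real (card X))\<^sup>2 \<le> exp (- (\<tau>\<^sup>2 * d / 2)) * (real (card \<Omega>) ^ d)\<^sup>2"
proof -
  define f where "f xs = (if xs \<in> X then 1 else 0 :: real)" for xs
  define K where "K = exp \<tau> * (1 + 1 / exp \<tau>)\<^sup>2 / 4"
  have sf: "sum f (words \<Omega> d) = card X"
    unfolding f_def using X finite_words[OF fin(1), of d] by (simp add: sum.If_cases Int_absorb1)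
  have "sum f (words \<Omega> d) * sum f (words \<Omega> d) \<le> exp (- (\<tau>\<^sup>2 * d)) * ((real (card \<Omega>))\<^sup>2 * (exp \<tau> * (1 + 1 / exp \<tau>)\<^sup>2 / 4)) ^ d"
  proof (rule sum_mult_sum_words_le[OF fin \<pi>])
    fix xs ys
    show "f xs * f ys \<le> exp (- (\<tau>\<^sup>2 * d)) * exp \<tau> ^ mismatches \<pi> xs ys"
    proof (cases "xs \<in> X \<and> ys \<in> X")
      case True
      then have "\<tau> * d \<le> real (mismatches \<pi> xs ys)" using far by (simp add: less_imp_le)
      then have "\<tau> * (\<tau> * d) \<le> \<tau> * real (mismatches \<pi> xs ys)" using \<tau> by (intro mult_left_mono)
      then have "1 \<le> exp (- (\<tau>\<^sup>2 * d) + real (mismatches \<pi> xs ys) * \<tau>)" by (simp add: power2_eq_square mult_ac)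
      also have "\<dots> = exp (- (\<tau>\<^sup>2 * d)) * exp \<tau> ^ mismatches \<pi> xs ys"
        unfolding exp_add exp_of_nat_mult ..
      finally show ?thesis using True by (simp add: f_def)
    qed (auto simp: f_def)
  qed (use \<tau> in \<open>auto simp: f_def\<close>)
  also have "\<dots> = exp (- (\<tau>\<^sup>2 * d)) * K ^ d * (real (card \<Omega>) ^ d)\<^sup>2"
    unfolding K_def[symmetric] by (simp add: power_mult_distrib mult_ac flip: power_mult)
  also have "\<dots> \<le> exp (- (\<tau>\<^sup>2 * d)) * exp (\<tau>\<^sup>2 / 2) ^ d * (real (card \<Omega>) ^ d)\<^sup>2"
    unfolding K_def using cosh_type_bound[OF \<tau>] by (intro mult_right_mono mult_left_mono power_mono) auto
  also have "exp (- (\<tau>\<^sup>2 * d)) * exp (\<tau>\<^sup>2 / 2) ^ d = exp (- (\<tau>\<^sup>2 * d / 2))"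
    by (simp add: exp_of_nat_mult[symmetric] exp_add[symmetric])
  finally show ?thesis by (simp add: sf power2_eq_square)
qed

section \<open>The lower bound\<close>

text \<open>
  The multipliers \<open>r i\<close> and the shifts \<open>h j\<close> make \<open>x \<mapsto> (r i * x / p)\<^sub>i\<close> map the cube spanned by the
  \<open>h j\<close> to an approximate copy of the grid of multiples of \<open>1 / q\<close> in the torus.
\<close>

definition grid_system :: "nat \<Rightarrow> nat \<Rightarrow> nat \<Rightarrow> real \<Rightarrow> (nat \<Rightarrow> int) \<Rightarrow> (nat \<Rightarrow> int) \<Rightarrow> bool" where
  "grid_system p q d \<eta> r h \<longleftrightarrow> (\<forall>\<omega>. (\<forall>j<d. \<bar>\<omega> j\<bar> \<le> int q) \<longrightarrow>
     (\<forall>i<d. \<exists>n::int. \<bar>real_of_int (r i * (\<Sum>j<d. \<omega> j * h j)) / p - real_of_int (\<omega> i) / q - n\<bar> \<le> \<eta>))"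

text \<open>With \<open>r i = M ^ i\<close> and \<open>h j\<close> about
  \<open>p / (q * M ^ j)\<close>, the product \<open>r i * h j / p\<close> is about
  \<open>M ^ i / (q * M ^ j)\<close>. This is \<open>1 / q\<close> for \<open>i = j\<close>, an
  integer for \<open>i > j\<close> because \<open>q\<close> divides \<open>M\<close>, and tiny for
  \<open>i < j\<close>. Rounding \<open>h j\<close> to an integer costs at most
  \<open>q * M ^ d / p\<close>, which vanishes as \<open>p\<close> grows.\<close>

lemma grid_system_exists:
  fixes \<eta> :: real
  assumes q: "q \<ge> 2" and \<eta>: "\<eta> > 0"
  shows "\<exists>P0. \<forall>p\<ge>P0. \<exists>r h. grid_system p q d \<eta> r h"
proof -
  obtain N0 :: nat where N0: "N0 > 2 * d / \<eta>" using reals_Archimedean2 by blast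
  \<comment> \<open>The factor \<open>q\<close> makes the terms below the diagonal integral; the
    factor \<open>N0 + 1\<close> makes the \<open>d\<close> errors of size \<open>1 / M\<close> add
    up to at most \<open>\<eta> / 2\<close>.\<close>
  define M where "M = q * (N0 + 1)"
  have M: "M > 0" using q by (simp add: M_def)
  have "1 * (N0 + 1) \<le> q * (N0 + 1)" using q by (intro mult_le_mono1) simp
  then have "N0 + 1 \<le> M" unfolding M_def by simp
  then have "N0 \<le> M" by simp
  then have "2 * d / \<eta> \<le> M" using N0 by linarith
  then have M_big: "d / M \<le> \<eta> / 2" using M \<eta> by (simp add: field_simps)
  obtain P0 :: nat where P0: "P0 > 2 * d * q * M ^ d / \<eta>" using reals_Archimedean2 by blast
  have "\<exists>r h. grid_system p q d \<eta> r h" if p: "p \<ge> P0 + 1" for p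
  proof -
    have "2 * d * q * M ^ d / \<eta> \<le> p" using P0 p by linarith
    then have p_big: "d * (q * M ^ d / p) \<le> \<eta> / 2" using p \<eta> by (simp add: field_simps)
    have p0: "real p > 0" using p by simp
    define r where "r i = int (M ^ i)" for i
    define h where "h j = int (p div (q * M ^ j))" for j
    have "grid_system p q d \<eta> r h"
      unfolding grid_system_def
    proof (intro allI impI)
      fix \<omega> :: "nat \<Rightarrow> int" and i
      assume \<omega>: "\<forall>j<d. \<bar>\<omega> j\<bar> \<le> int q" and i: "i < d"
      define \<theta> where "\<theta> j = (if j = i then real_of_int (\<omega> i) / q else 0)" for j
      define n where "n j = (if j < i then \<omega> j * int (M ^ (i - j) div q) else 0)" for j
      have term_le: "\<bar>real_of_int (r i * (\<omega> j * h j)) / p - \<theta> j - n j\<bar> \<le> 1 / M + q * M ^ d / p" if j: "j < d" for j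
      proof -
        define \<delta> where "\<delta> = real p / real (q * M ^ j) - real (p div (q * M ^ j))"
        have qM: "real (q * M ^ j) > 0" using q M by simp
        have "real p = real (q * M ^ j) * real (p div (q * M ^ j)) + real (p mod (q * M ^ j))"
          by (simp only: of_nat_add[symmetric] of_nat_mult[symmetric] mult_div_mod_eq)
        then have "real p / real (q * M ^ j) = (real (q * M ^ j) * real (p div (q * M ^ j)) + real (p mod (q * M ^ j))) / real (q * M ^ j)"
          by simp
        also have "\<dots> = real (p div (q * M ^ j)) + real (p mod (q * M ^ j)) / real (q * M ^ j)"
          using qM by (simp only: add_divide_distrib nonzero_mult_div_cancel_left)
        finally have \<delta>_eq: "\<delta> = real (p mod (q * M ^ j)) / real (q * M ^ j)" unfolding \<delta>_def by simp
        have "p mod (q * M ^ j) < q * M ^ j" using q M by simp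
        then have "\<delta> \<le> 1" unfolding \<delta>_eq using qM by (simp add: divide_le_eq_1 del: of_nat_mult of_nat_power)
        then have \<delta>: "0 \<le> \<delta>" "\<delta> \<le> 1" unfolding \<delta>_eq by auto
        have \<omega>j: "\<bar>real_of_int (\<omega> j)\<bar> \<le> q"
        proof -
          have "real_of_int \<bar>\<omega> j\<bar> \<le> real_of_int (int q)" using \<omega> j by (subst of_int_le_iff) blast
          then show ?thesis by simp
        qed
        have "real_of_int (r i * (\<omega> j * h j)) / p = M ^ i * \<omega> j * (real p / (q * M ^ j) - \<delta>) / p"
          unfolding r_def h_def \<delta>_def by simp
        also have "\<dots> = \<omega> j * (M ^ i / (q * M ^ j)) - M ^ i * \<omega> j * \<delta> / p"
          using p0 by (simp add: field_simps)
        finally have eq: "real_of_int (r i * (\<omega> j * h j)) / p = \<omega> j * (M ^ i / (q * M ^ j)) - M ^ i * \<omega> j * \<delta> / p" .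
        have "\<bar>M ^ i * \<omega> j * \<delta> / p\<bar> = M ^ i * \<bar>real_of_int (\<omega> j)\<bar> * \<delta> / p"
          using \<delta> by (simp add: abs_mult)
        also have "\<dots> \<le> M ^ d * q * 1 / p"
        proof -
          have "real M ^ i \<le> real M ^ d" using i M by (intro power_increasing) auto
          then have "real M ^ i * \<bar>real_of_int (\<omega> j)\<bar> * \<delta> \<le> real M ^ d * real q * 1"
            using \<omega>j \<delta> by (intro mult_mono) auto
          then show ?thesis using p0 by (simp add: divide_right_mono)
        qed
        finally have e1: "\<bar>M ^ i * \<omega> j * \<delta> / p\<bar> \<le> q * M ^ d / p" by (simp add: mult.commute)
        have "\<bar>\<omega> j * (M ^ i / (q * M ^ j)) - \<theta> j - n j\<bar> \<le> 1 / M"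
        proof (cases i j rule: linorder_cases)
          case less
          then have "M ^ j = M ^ i * M ^ (j - i)" by (simp flip: power_add)
          then have "real M ^ j = real M ^ i * real M ^ (j - i)" by (metis of_nat_mult of_nat_power)
          then have "\<omega> j * (M ^ i / (q * M ^ j)) = \<omega> j / q / M ^ (j - i)" using M by simp
          then have "\<bar>\<omega> j * (M ^ i / (q * M ^ j)) - \<theta> j - n j\<bar> = \<bar>real_of_int (\<omega> j)\<bar> / q / M ^ (j - i)"
            using less by (simp add: \<theta>_def n_def abs_mult)
          also have "\<dots> \<le> 1 / M ^ (j - i)" using \<omega>j q by (intro divide_right_mono) (auto simp: divide_le_eq_1)
          also have "\<dots> \<le> 1 / M ^ 1"
            using less M power_increasing[of 1 "j - i" "real M"] by (intro divide_left_mono) auto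
          finally show ?thesis by simp
        next
          case equal
          then show ?thesis using M by (simp add: \<theta>_def n_def)
        next
          case greater
          then have "M ^ i = M ^ (i - j) * M ^ j" by (simp flip: power_add)
          then have Mi: "real M ^ i = real M ^ (i - j) * real M ^ j" by (metis of_nat_mult of_nat_power)
          have "q dvd M" by (simp add: M_def)
          moreover have "M dvd M ^ (i - j)" using greater by (intro dvd_power) simp
          ultimately have "q dvd M ^ (i - j)" by (rule dvd_trans)
          then have "real (M ^ (i - j) div q) = real M ^ (i - j) / q" by (simp add: real_of_nat_div)
          then have "real_of_int (n j) = \<omega> j * (M ^ i / (q * M ^ j))"
            using greater M by (simp add: n_def Mi)
          then show ?thesis using greater by (simp add: \<theta>_def)
        qed
        then show ?thesis using e1 unfolding eq by linarith
      qed
      have "(\<Sum>j<d. \<theta> j) = real_of_int (\<omega> i) / q" unfolding \<theta>_def using i by simp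
      then have "real_of_int (r i * (\<Sum>j<d. \<omega> j * h j)) / p - real_of_int (\<omega> i) / q - real_of_int (\<Sum>j<d. n j)
          = (\<Sum>j<d. real_of_int (r i * (\<omega> j * h j)) / p - \<theta> j - n j)"
        by (simp add: sum_subtractf sum_divide_distrib sum_distrib_left)
      also have "\<bar>\<dots>\<bar> \<le> (\<Sum>j<d. 1 / M + q * M ^ d / p)"
        using term_le by (intro order_trans[OF sum_abs] sum_mono) auto
      also have "\<dots> = d / M + d * (q * M ^ d / p)" by (simp add: distrib_left)
      also have "\<dots> \<le> \<eta>" using M_big p_big by linarith
      finally show "\<exists>n::int. \<bar>real_of_int (r i * (\<Sum>j<d. \<omega> j * h j)) / p - real_of_int (\<omega> i) / q - n\<bar> \<le> \<eta>" by blast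
    qed
    then show ?thesis by blast
  qed
  then show ?thesis by blast
qed

section \<open>Residues whose torus coordinates are mostly close to \<open>1 / q\<close>\<close>

definition off_coordinates :: "nat \<Rightarrow> nat \<Rightarrow> nat \<Rightarrow> (nat \<Rightarrow> int) \<Rightarrow> real \<Rightarrow> int \<Rightarrow> nat set" where
  "off_coordinates p q d r \<eta> x = {j. j < d \<and> \<not> (\<exists>n::int. \<bar>real_of_int (r j * x) / p - 1 / q - n\<bar> \<le> \<eta>)}"

definition torus_set :: "nat \<Rightarrow> nat \<Rightarrow> nat \<Rightarrow> (nat \<Rightarrow> int) \<Rightarrow> real \<Rightarrow> real \<Rightarrow> int set" where
  "torus_set p q d r \<eta> \<tau> = {x\<in>{0..<int p}. real (card (off_coordinates p q d r \<eta> x)) \<le> \<tau> * d}"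

lemma finite_off_coordinates: "finite (off_coordinates p q d r \<eta> x)"
  by (simp add: off_coordinates_def)

lemma off_coordinates_mod:
  assumes "p > 0"
  shows "off_coordinates p q d r \<eta> (x mod int p) = off_coordinates p q d r \<eta> x"
proof -
  have *: "real_of_int (r j * (x mod int p)) / p = real_of_int (r j * x) / p - real_of_int (r j * (x div int p))" for j
  proof -
    have "x mod int p = x - int p * (x div int p)" by (simp add: minus_div_mult_eq_mod[symmetric] mult.commute)
    then have "real_of_int (x mod int p) = real_of_int (x - int p * (x div int p))" by (rule arg_cong)
    then have eq: "real_of_int (x mod int p) = real_of_int x - p * real_of_int (x div int p)" by simp
    show ?thesis unfolding of_int_mult eq using assms by (simp add: field_simps)
  qed
  have "(\<exists>n::int. \<bar>real_of_int (r j * (x mod int p)) / p - 1 / q - n\<bar> \<le> \<eta>) \<longleftrightarrow>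
      (\<exists>n::int. \<bar>real_of_int (r j * x) / p - 1 / q - n\<bar> \<le> \<eta>)" for j
    unfolding *
  proof
    assume "\<exists>n::int. \<bar>real_of_int (r j * x) / p - real_of_int (r j * (x div int p)) - 1 / q - n\<bar> \<le> \<eta>"
    then obtain n :: int where "\<bar>real_of_int (r j * x) / p - real_of_int (r j * (x div int p)) - 1 / q - n\<bar> \<le> \<eta>" by blast
    then show "\<exists>n::int. \<bar>real_of_int (r j * x) / p - 1 / q - n\<bar> \<le> \<eta>"
      by (intro exI[of _ "n + r j * (x div int p)"]) (simp add: algebra_simps)
  next
    assume "\<exists>n::int. \<bar>real_of_int (r j * x) / p - 1 / q - n\<bar> \<le> \<eta>"
    then obtain n :: int where "\<bar>real_of_int (r j * x) / p - 1 / q - n\<bar> \<le> \<eta>" by blast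
    then show "\<exists>n::int. \<bar>real_of_int (r j * x) / p - real_of_int (r j * (x div int p)) - 1 / q - n\<bar> \<le> \<eta>"
      by (intro exI[of _ "n - r j * (x div int p)"]) (simp add: algebra_simps)
  qed
  then show ?thesis unfolding off_coordinates_def by simp
qed

text \<open>As \<open>k * \<tau> < 1\<close>, the exceptional coordinates of the \<open>k\<close>
  variables do not exhaust all \<open>d\<close>. At a remaining coordinate the weighted deviations
  of a solution add up to an integer minus \<open>C / q\<close>. This is a nonzero multiple of
  \<open>1 / q\<close>, yet smaller than \<open>1 / q\<close> in absolute value.\<close>

lemma solution_free_torus_set:
  assumes p: "p > 0" and q: "q > 0" "\<not> int q dvd (\<Sum>i=1..k. c i)"
    and \<eta>: "\<eta> * real_of_int (\<Sum>i=1..k. \<bar>c i\<bar>) < 1 / q"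
    and \<tau>: "k * \<tau> < 1" and d: "d > 0"
  shows "solution_free k c p (torus_set p q d r \<eta> \<tau>)"
  unfolding solution_free_def
proof
  assume "\<exists>a. inj_on a {1..k} \<and> a ` {1..k} \<subseteq> torus_set p q d r \<eta> \<tau> \<and> [\<Sum>i=1..k. c i * a i = 0] (mod int p)"
  then obtain a where a: "a ` {1..k} \<subseteq> torus_set p q d r \<eta> \<tau>" "[\<Sum>i=1..k. c i * a i = 0] (mod int p)" by blast
  define B where "B = (\<Union>i\<in>{1..k}. off_coordinates p q d r \<eta> (a i))"
  have "card B \<le> (\<Sum>i=1..k. card (off_coordinates p q d r \<eta> (a i)))" unfolding B_def by (rule card_UN_le) simp
  then have "real (card B) \<le> (\<Sum>i=1..k. real (card (off_coordinates p q d r \<eta> (a i))))"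
    by (simp flip: of_nat_sum)
  also have "\<dots> \<le> (\<Sum>i=1..k. \<tau> * d)" using a(1) by (intro sum_mono) (auto simp: torus_set_def image_subset_iff)
  also have "\<dots> = (k * \<tau>) * d" by simp
  also have "\<dots> < d" using mult_strict_right_mono[OF \<tau>, of "real d"] d by simp
  finally have "card B < card {..<d}" by simp
  then have "\<not> {..<d} \<subseteq> B" using card_mono[of B "{..<d}"] by (auto simp: B_def finite_off_coordinates)
  then obtain j where j: "j < d" "j \<notin> B" by blast
  have "\<forall>i\<in>{1..k}. \<exists>n::int. \<bar>real_of_int (r j * a i) / p - 1 / q - n\<bar> \<le> \<eta>"
    using j by (auto simp: B_def off_coordinates_def)
  from bchoice[OF this] obtain n :: "nat \<Rightarrow> int"
    where n: "\<forall>i\<in>{1..k}. \<bar>real_of_int (r j * a i) / p - 1 / q - n i\<bar> \<le> \<eta>" by blast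
  obtain I where I: "(\<Sum>i=1..k. c i * a i) = int p * I" using a(2) by (auto simp: cong_0_iff)
  define m where "m = r j * I - (\<Sum>i=1..k. c i * n i)"
  define C where "C = (\<Sum>i=1..k. c i)"
  have "(\<Sum>i=1..k. c i * (real_of_int (r j * a i) / p - 1 / q - n i))
      = r j * real_of_int (\<Sum>i=1..k. c i * a i) / p - real_of_int C / q - real_of_int (\<Sum>i=1..k. c i * n i)"
    by (simp add: C_def algebra_simps sum_subtractf sum.distrib sum_divide_distrib sum_distrib_left)
  also have "r j * real_of_int (\<Sum>i=1..k. c i * a i) / p = real_of_int (r j * I)"
    unfolding I using p by simp
  finally have eq: "(\<Sum>i=1..k. c i * (real_of_int (r j * a i) / p - 1 / q - n i)) = real_of_int m - real_of_int C / q"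
    by (simp add: m_def)
  have "\<bar>\<Sum>i=1..k. c i * (real_of_int (r j * a i) / p - 1 / q - n i)\<bar> \<le> (\<Sum>i=1..k. \<bar>real_of_int (c i)\<bar> * \<eta>)"
    using n by (intro order_trans[OF sum_abs] sum_mono) (auto simp: abs_mult intro!: mult_left_mono)
  also have "\<dots> = \<eta> * real_of_int (\<Sum>i=1..k. \<bar>c i\<bar>)" by (simp add: sum_distrib_left mult.commute)
  also have "\<dots> < 1 / q" by fact
  finally have "\<bar>real_of_int m - real_of_int C / q\<bar> < 1 / q" unfolding eq .
  then have "q * \<bar>real_of_int m - real_of_int C / q\<bar> < q * (1 / q)" using q by (intro mult_strict_left_mono) auto
  then have "\<bar>q * (real_of_int m - real_of_int C / q)\<bar> < 1" using q by (simp add: abs_mult)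
  then have "\<bar>real_of_int (int q * m - C)\<bar> < 1" using q by (simp add: algebra_simps)
  then have "int q * m - C = 0" by linarith
  then have "C = int q * m" by linarith
  then have "int q dvd C" by simp
  then show False using q by (simp add: C_def)
qed

lemma torus_set_memI:
  fixes \<tau> :: real
  assumes "p > 0" "real (card (off_coordinates p q d r \<eta> x)) \<le> \<tau> * d"
  shows "x mod int p \<in> torus_set p q d r \<eta> \<tau>"
  using assms by (simp add: torus_set_def off_coordinates_mod)

lemma exists_large_fiber:
  assumes "finite A" "f ` A \<subseteq> B" "finite B" "B \<noteq> {}"
  shows "\<exists>y\<in>B. card A \<le> card B * card {x\<in>A. f x = y}"
proof (rule ccontr)
  assume "\<not> ?thesis"
  then have *: "card B * card {x\<in>A. f x = y} < card A" if "y \<in> B" for y using that by (simp add: not_le)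
  have "A = (\<Union>y\<in>B. {x\<in>A. f x = y})" using assms(2) by blast
  then have "card A \<le> (\<Sum>y\<in>B. card {x\<in>A. f x = y})" using card_UN_le[OF assms(3), of "\<lambda>y. {x\<in>A. f x = y}"] by simp
  then have "card B * card A \<le> (\<Sum>y\<in>B. card B * card {x\<in>A. f x = y})" by (simp flip: sum_distrib_left)
  also have "\<dots> < (\<Sum>y\<in>B. card A)" using assms * by (intro sum_strict_mono) auto
  finally show False by simp
qed

text \<open>Pigeonhole on the \<open>m ^ d\<close> boxes of side \<open>1 / m\<close> in the torus.
  Residues in a fullest box differ by vectors close to \<open>0\<close>, so the translation that
  takes one of them to the sum of the \<open>h j\<close>, whose coordinates are all close to
  \<open>1 / q\<close>, takes all of them into the set. Each approximation uses half of
  \<open>\<eta>\<close>.\<close>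

lemma card_torus_set_ge:
  assumes p: "p > 0" and m: "m > 0" "1 / m \<le> \<eta> / 2" and grid: "grid_system p q d (\<eta> / 2) r h" and q: "q > 0"
    and \<tau>: "\<tau> \<ge> 0"
  shows "real p / real m ^ d \<le> card (torus_set p q d r \<eta> \<tau>)"
proof -
  define P where "P = {0..<int p}"
  define F where "F x = (\<lambda>j\<in>{..<d}. nat \<lfloor>m * frac (real_of_int (r j * x) / p)\<rfloor>)" for x
  define B where "B = PiE {..<d} (\<lambda>_. {..<m})"
  have cB: "card B = m ^ d" unfolding B_def by (simp add: card_PiE)
  have "finite B" unfolding B_def by (intro finite_PiE) auto
  moreover have "B \<noteq> {}" using cB m by (metis card.empty power_eq_0_iff neq0_conv)
  moreover have "F ` P \<subseteq> B"
  proof (intro image_subsetI)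
    fix x
    have "nat \<lfloor>m * frac y\<rfloor> < m" for y
    proof -
      have "m * frac y < m" using m mult_strict_left_mono[OF frac_lt_1[of y], of "real m"] by simp
      then show ?thesis using frac_ge_0[of y] by (simp add: nat_less_iff floor_less_iff)
    qed
    then show "F x \<in> B" unfolding F_def B_def by auto
  qed
  ultimately obtain y where y: "card P \<le> card B * card {x\<in>P. F x = y}"
    using exists_large_fiber[of P F B] by (auto simp: P_def)
  define G where "G = {x\<in>P. F x = y}"
  have finG: "finite G" unfolding G_def P_def by (rule finite_subset[of _ "{0..<int p}"]) auto
  have "card P = p" by (simp add: P_def)
  then have pG: "p \<le> m ^ d * card G" using y cB by (simp add: G_def)
  then have "card G > 0" using p by (intro gr0I) auto
  then obtain x0 where x0: "x0 \<in> G" using finG by (metis card_gt_0_iff ex_in_conv)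
  define s where "s = (\<Sum>j<d. h j) - x0"
  have "(\<lambda>x. (x + s) mod int p) ` G \<subseteq> torus_set p q d r \<eta> \<tau>"
  proof (intro image_subsetI torus_set_memI[OF p])
    fix x assume x: "x \<in> G"
    have "\<exists>n::int. \<bar>real_of_int (r j * (x + s)) / p - 1 / q - n\<bar> \<le> \<eta>" if j: "j < d" for j
    proof -
      have "F x j = F x0 j" using x x0 by (simp add: G_def)
      then have "nat \<lfloor>m * frac (real_of_int (r j * x) / p)\<rfloor> = nat \<lfloor>m * frac (real_of_int (r j * x0) / p)\<rfloor>"
        using j by (simp add: F_def)
      moreover have "m * frac z \<ge> 0" for z using frac_ge_0[of z] by simp
      ultimately have "\<lfloor>m * frac (real_of_int (r j * x) / p)\<rfloor> = \<lfloor>m * frac (real_of_int (r j * x0) / p)\<rfloor>"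
        by (simp add: nat_eq_iff)
      then have "\<bar>m * frac (real_of_int (r j * x) / p) - m * frac (real_of_int (r j * x0) / p)\<bar> \<le> 1"
        by linarith
      then have "m * \<bar>frac (real_of_int (r j * x) / p) - frac (real_of_int (r j * x0) / p)\<bar> \<le> 1"
        by (simp add: abs_mult flip: right_diff_distrib)
      then have 1: "\<bar>frac (real_of_int (r j * x) / p) - frac (real_of_int (r j * x0) / p)\<bar> \<le> \<eta> / 2"
        using m by (intro order_trans[OF _ m(2)]) (simp add: field_simps)
      obtain n :: int where n: "\<bar>real_of_int (r j * (\<Sum>j<d. h j)) / p - 1 / q - n\<bar> \<le> \<eta> / 2"
        using grid[unfolded grid_system_def, THEN spec[of _ "\<lambda>_. 1"]] j q by auto
      define n' where "n' = n + \<lfloor>real_of_int (r j * x) / p\<rfloor> - \<lfloor>real_of_int (r j * x0) / p\<rfloor>"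
      have n'_eq: "real_of_int n' = n + \<lfloor>real_of_int (r j * x) / p\<rfloor> - \<lfloor>real_of_int (r j * x0) / p\<rfloor>"
        by (simp add: n'_def)
      have eq: "real_of_int (r j * (x + s)) / p = real_of_int (r j * x) / p - real_of_int (r j * x0) / p + real_of_int (r j * (\<Sum>j<d. h j)) / p"
        by (simp add: s_def algebra_simps add_divide_distrib diff_divide_distrib)
      have "\<bar>real_of_int (r j * (x + s)) / p - 1 / q - n'\<bar> \<le> \<eta>"
        using 1 n unfolding eq n'_eq frac_def by linarith
      then show ?thesis by blast
    qed
    then have "off_coordinates p q d r \<eta> (x + s) = {}" by (auto simp: off_coordinates_def)
    then show "real (card (off_coordinates p q d r \<eta> (x + s))) \<le> \<tau> * d" using \<tau> by simp
  qed
  moreover have "inj_on (\<lambda>x. (x + s) mod int p) G"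
  proof
    fix x x' assume *: "x \<in> G" "x' \<in> G" "(x + s) mod int p = (x' + s) mod int p"
    then have "[x + s = x' + s] (mod int p)" by (simp add: cong_def)
    then have "[x = x'] (mod int p)" by (simp add: cong_add_rcancel)
    then show "x = x'" using * by (intro cong_less_imp_eq_int[of x "int p" x']) (auto simp: G_def P_def)
  qed
  moreover have "finite (torus_set p q d r \<eta> \<tau>)" by (rule finite_subset[of _ "{0..<int p}"]) (auto simp: torus_set_def)
  ultimately have "card G \<le> card (torus_set p q d r \<eta> \<tau>)" by (metis card_inj_on_le)
  then have "real (card G) \<le> card (torus_set p q d r \<eta> \<tau>)" by simp
  moreover have "real p \<le> real (m ^ d * card G)" using pG by (subst of_nat_le_iff)
  then have "real p / real m ^ d \<le> card G" using m by (simp add: field_simps)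
  ultimately show ?thesis by linarith
qed

lemma card_le_card_translate:
  assumes p: "p > 0" and I: "I \<subseteq> {0..<int p}"
  shows "card I \<le> card {t\<in>{0..<int p}. (t + s) mod int p \<in> I}"
proof (rule card_inj_on_le[where f = "\<lambda>u. (u - s) mod int p"])
  show "inj_on (\<lambda>u. (u - s) mod int p) I"
  proof
    fix u v assume *: "u \<in> I" "v \<in> I" "(u - s) mod int p = (v - s) mod int p"
    then have "[u - s + s = v - s + s] (mod int p)" by (intro cong_add cong_refl) (simp add: cong_def)
    then have "[u = v] (mod int p)" by simp
    then show "u = v" using * I by (intro cong_less_imp_eq_int[of u "int p" v]) auto
  qed
  show "(\<lambda>u. (u - s) mod int p) ` I \<subseteq> {t\<in>{0..<int p}. (t + s) mod int p \<in> I}"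
  proof (intro image_subsetI CollectI conjI)
    fix u assume u: "u \<in> I"
    show "(u - s) mod int p \<in> {0..<int p}" using p by simp
    have "((u - s) mod int p + s) mod int p = u mod int p" by (simp add: mod_add_left_eq)
    then show "((u - s) mod int p + s) mod int p \<in> I" using u I by auto
  qed
qed (rule finite_subset[of _ "{0..<int p}"], auto)

text \<open>By averaging over translates of the grid, some translate sends more than
  \<open>\<epsilon> * q ^ d\<close> words into an independent set that is too large. Concentration
  with \<open>\<pi>\<close> the cyclic shift by \<open>- 1\<close> gives two of these words whose
  letters differ by \<open>1\<close> modulo \<open>q\<close> in most places, and the grid property
  puts their difference into the connection set.\<close>

lemma independence_number_torus_set_le:
  fixes \<epsilon> :: real
  assumes p: "p > 0" and q: "q \<ge> 2" and \<eta>: "0 \<le> \<eta>" "\<eta> < 1 / q" and grid: "grid_system p q d \<eta> r h"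
    and \<tau>: "0 \<le> \<tau>" "\<tau> < 1" and d: "d > 0" and \<epsilon>: "exp (- (\<tau>\<^sup>2 * d / 4)) \<le> \<epsilon>"
  shows "real (independence_number (cayley_digraph p (torus_set p q d r \<eta> \<tau>))) \<le> \<epsilon> * p"
proof (rule ccontr)
  define A where "A = torus_set p q d r \<eta> \<tau>"
  assume "\<not> real (independence_number (cayley_digraph p (torus_set p q d r \<eta> \<tau>))) \<le> \<epsilon> * p"
  then obtain I where I: "independent_set (cayley_digraph p A) I" "real (card I) > \<epsilon> * p"
    using independence_number_attained[OF finite_pverts_cayley, of p A] by (auto simp: A_def)
  have Ip: "I \<subseteq> {0..<int p}" and I_indep: "\<And>u v. u \<in> I \<Longrightarrow> v \<in> I \<Longrightarrow> u \<noteq> v \<Longrightarrow> (v - u) mod int p \<notin> A"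
    using I(1) unfolding independent_set_cayley by auto
  define \<Omega> where "\<Omega> = {0..<int q}"
  have \<Omega>: "finite \<Omega>" "\<Omega> \<noteq> {}" "card \<Omega> = q" using q by (auto simp: \<Omega>_def)
  define \<pi> where "\<pi> x = (x - 1) mod int q" for x
  have "inj_on \<pi> \<Omega>"
  proof
    fix x y assume *: "x \<in> \<Omega>" "y \<in> \<Omega>" "\<pi> x = \<pi> y"
    then have "[x - 1 + 1 = y - 1 + 1] (mod int q)" by (intro cong_add cong_refl) (simp add: cong_def \<pi>_def)
    then have "[x = y] (mod int q)" by simp
    then show "x = y" using * by (intro cong_less_imp_eq_int[of x "int q" y]) (auto simp: \<Omega>_def)
  qed
  moreover have "\<pi> ` \<Omega> \<subseteq> \<Omega>" using q by (auto simp: \<pi>_def \<Omega>_def)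
  ultimately have \<pi>: "bij_betw \<pi> \<Omega> \<Omega>" using \<Omega>(1) by (simp add: bij_betw_def endo_inj_surj)
  define W where "W = words \<Omega> d"
  have finW: "finite W" and cW: "card W = q ^ d" unfolding W_def using finite_words card_words \<Omega> by auto
  define s where "s xs = (\<Sum>j<d. xs ! j * h j)" for xs
  define X where "X t = {xs\<in>W. (t + s xs) mod int p \<in> I}" for t
  have "real (q ^ d * card I) = (\<Sum>xs\<in>W. real (card I))" by (simp add: cW)
  also have "\<dots> \<le> (\<Sum>xs\<in>W. real (card {t\<in>{0..<int p}. (t + s xs) mod int p \<in> I}))"
    using card_le_card_translate[OF p Ip] by (intro sum_mono) simp
  also have "\<dots> = (\<Sum>xs\<in>W. \<Sum>t\<in>{0..<int p}. if (t + s xs) mod int p \<in> I then 1 else 0)"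
    by (intro sum.cong refl) (simp add: sum.If_cases Int_def)
  also have "\<dots> = (\<Sum>t\<in>{0..<int p}. \<Sum>xs\<in>W. if (t + s xs) mod int p \<in> I then 1 else 0)" by (rule sum.swap)
  also have "\<dots> = (\<Sum>t\<in>{0..<int p}. real (card (X t)))"
    unfolding X_def using finW by (intro sum.cong refl) (simp add: sum.If_cases Int_def)
  finally have sum_X: "real (q ^ d * card I) \<le> (\<Sum>t\<in>{0..<int p}. real (card (X t)))" .
  have "\<exists>t. real (card (X t)) > \<epsilon> * q ^ d"
  proof (rule ccontr)
    assume "\<not> ?thesis"
    then have "(\<Sum>t\<in>{0..<int p}. real (card (X t))) \<le> (\<Sum>t\<in>{0..<int p}. \<epsilon> * q ^ d)"
      by (intro sum_mono) (simp add: not_less)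
    then have "real q ^ d * card I \<le> real q ^ d * (\<epsilon> * p)" using sum_X by (simp add: mult_ac)
    then show False using I(2) q by simp
  qed
  then obtain t where t: "real (card (X t)) > \<epsilon> * q ^ d" by blast
  have "\<exists>xs\<in>X t. \<exists>ys\<in>X t. real (mismatches \<pi> xs ys) \<le> \<tau> * d"
  proof (rule ccontr)
    assume neg: "\<not> ?thesis"
    have far: "real (mismatches \<pi> xs ys) > \<tau> * d" if "xs \<in> X t" "ys \<in> X t" for xs ys
      using neg that by (meson not_le)
    have "(real (card (X t)))\<^sup>2 \<le> exp (- (\<tau>\<^sup>2 * d / 2)) * (real (card \<Omega>) ^ d)\<^sup>2"
      using \<tau> by (intro words_concentration[OF \<Omega>(1,2) \<pi>] far) (auto simp: X_def W_def)
    also have "exp (- (\<tau>\<^sup>2 * d / 2)) = (exp (- (\<tau>\<^sup>2 * d / 4)))\<^sup>2" by (simp flip: exp_double)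
    also have "\<dots> * (real (card \<Omega>) ^ d)\<^sup>2 \<le> \<epsilon>\<^sup>2 * (real (card \<Omega>) ^ d)\<^sup>2"
      using \<epsilon> by (intro mult_right_mono power_mono) auto
    also have "\<dots> = (\<epsilon> * q ^ d)\<^sup>2" using \<Omega> by (simp add: power_mult_distrib)
    finally have "real (card (X t)) \<le> \<epsilon> * q ^ d" using \<epsilon> order_trans[OF exp_ge_zero \<epsilon>]
      by (intro power2_le_imp_le[of "real (card (X t))"]) auto
    then show False using t by simp
  qed
  then obtain xs ys where xy: "xs \<in> X t" "ys \<in> X t" "real (mismatches \<pi> xs ys) \<le> \<tau> * d" by blast
  have len: "length xs = d" "length ys = d" and set: "set xs \<subseteq> \<Omega>" "set ys \<subseteq> \<Omega>"
    using xy by (auto simp: X_def W_def words_def)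
  define \<omega> where "\<omega> j = xs ! j - ys ! j" for j
  have \<Omega>j: "xs ! j \<in> \<Omega>" "ys ! j \<in> \<Omega>" if "j < d" for j using len set that nth_mem by (auto simp: subset_iff)
  have \<omega>q: "\<forall>j<d. \<bar>\<omega> j\<bar> \<le> int q"
  proof (intro allI impI)
    fix j assume "j < d"
    from \<Omega>j[OF this] show "\<bar>\<omega> j\<bar> \<le> int q" by (auto simp: \<omega>_def \<Omega>_def)
  qed
  define w where "w = (\<Sum>j<d. \<omega> j * h j)"
  have w: "w = s xs - s ys" by (simp add: w_def s_def \<omega>_def left_diff_distrib sum_subtractf)
  have "off_coordinates p q d r \<eta> w \<subseteq> {j. j < d \<and> ys ! j \<noteq> \<pi> (xs ! j)}"
  proof
    fix j assume j: "j \<in> off_coordinates p q d r \<eta> w"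
    then have jd: "j < d" by (simp add: off_coordinates_def)
    have "ys ! j \<noteq> \<pi> (xs ! j)"
    proof
      assume "ys ! j = \<pi> (xs ! j)"
      then have "xs ! j - 1 = int q * ((xs ! j - 1) div int q) + ys ! j" by (simp add: \<pi>_def)
      then have eq: "\<omega> j = 1 + int q * ((xs ! j - 1) div int q)" by (simp add: \<omega>_def)
      obtain n :: int where n: "\<bar>real_of_int (r j * w) / p - real_of_int (\<omega> j) / q - n\<bar> \<le> \<eta>"
        using grid \<omega>q jd unfolding grid_system_def w_def by blast
      have "real_of_int (\<omega> j) / q = 1 / q + real_of_int ((xs ! j - 1) div int q)"
        unfolding eq using q by (simp add: add_divide_distrib)
      with n have "\<bar>real_of_int (r j * w) / p - 1 / q - real_of_int (n + (xs ! j - 1) div int q)\<bar> \<le> \<eta>"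
        by (simp add: algebra_simps)
      then show False using j unfolding off_coordinates_def by blast
    qed
    then show "j \<in> {j. j < d \<and> ys ! j \<noteq> \<pi> (xs ! j)}" using jd by simp
  qed
  then have "card (off_coordinates p q d r \<eta> w) \<le> card {j. j < d \<and> ys ! j \<noteq> \<pi> (xs ! j)}" by (intro card_mono) auto
  also have "\<dots> = mismatches \<pi> xs ys" unfolding mismatches_def length_filter_conv_card using len
    by (intro arg_cong[where f = card]) auto
  finally have off_w: "real (card (off_coordinates p q d r \<eta> w)) \<le> \<tau> * d" using xy(3) by linarith
  define u where "u = (t + s xs) mod int p"
  define v where "v = (t + s ys) mod int p"
  have uv: "u \<in> I" "v \<in> I" using xy by (auto simp: u_def v_def X_def)
  have uvw: "(u - v) mod int p = w mod int p" by (simp add: u_def v_def w mod_diff_eq)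
  then have "(u - v) mod int p \<in> A" unfolding A_def using torus_set_memI[OF p off_w] by simp
  \<comment> \<open>Independence says nothing about equal vertices. If \<open>u = v\<close>, then
    \<open>p\<close> divides \<open>w\<close>, so all coordinates of \<open>w\<close> are integers;
    these are at distance at least \<open>1 / q > \<eta>\<close> from the target, and all
    \<open>d\<close> coordinates would be off.\<close>
  moreover have "u \<noteq> v"
  proof
    assume "u = v"
    then have "w mod int p = 0" using uvw by simp
    then have "off_coordinates p q d r \<eta> w = off_coordinates p q d r \<eta> 0" using off_coordinates_mod[OF p, of q d r \<eta> w] by simp
    also have "\<dots> = {..<d}"
    proof -
      have "\<not> \<bar>real_of_int (r j * 0) / p - 1 / q - real_of_int n\<bar> \<le> \<eta>" for j and n :: int
      proof
        assume "\<bar>real_of_int (r j * 0) / p - 1 / q - real_of_int n\<bar> \<le> \<eta>"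
        then have "\<bar>1 / q + real_of_int n\<bar> < 1 / q" using \<eta> by simp
        then have "q * \<bar>1 / q + real_of_int n\<bar> < q * (1 / q)" using q by (intro mult_strict_left_mono) auto
        then have "\<bar>q * (1 / q + real_of_int n)\<bar> < 1" using q by (simp add: abs_mult)
        then have "\<bar>real_of_int (1 + int q * n)\<bar> < 1" using q by (simp add: distrib_left)
        then have "1 + int q * n = 0" by linarith
        then have "int q * (- n) = 1" by linarith
        then have "int q dvd 1" by (metis dvd_triv_left)
        then show False using q by simp
      qed
      then show ?thesis by (auto simp: off_coordinates_def)
    qed
    finally have "real d \<le> \<tau> * d" using off_w by simp
    then show False using \<tau> d by simp
  qed
  ultimately show False using I_indep[OF uv(2) uv(1)] by simp
qed

section \<open>The limiting density\<close>

lemma grid_system_mono: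
  "grid_system p q d \<eta> r h \<Longrightarrow> \<eta> \<le> \<eta>' \<Longrightarrow> grid_system p q d \<eta>' r h"
  unfolding grid_system_def by (meson order_trans)

lemma finite_admissible_cards:
  "finite {card A | A. A \<subseteq> carrier (residue_ring (int p)) \<and> solution_free k c p A \<and>
     real (independence_number (cayley_digraph p A)) \<le> \<epsilon> * real p}"
  by (rule finite_subset[of _ "card ` Pow {0..<int p}"]) (auto simp: carrier_residue_ring)

lemma card_le_max_solution_free:
  assumes "A \<subseteq> {0..<int p}" "solution_free k c p A" "real (independence_number (cayley_digraph p A)) \<le> \<epsilon> * real p"
  shows "card A \<le> max_solution_free k c \<epsilon> p"
proof -
  have "card A \<in> {card A | A. A \<subseteq> carrier (residue_ring (int p)) \<and> solution_free k c p A \<and>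
     real (independence_number (cayley_digraph p A)) \<le> \<epsilon> * real p}"
    unfolding carrier_residue_ring using assms by blast
  then show ?thesis unfolding max_solution_free_def
    using finite_admissible_cards by (intro Max_ge) auto
qed

lemma max_solution_free_le:
  assumes "b \<ge> 0"
    and "\<And>A. A \<subseteq> {0..<int p} \<Longrightarrow> solution_free k c p A \<Longrightarrow>
      real (independence_number (cayley_digraph p A)) \<le> \<epsilon> * real p \<Longrightarrow> real (card A) \<le> b"
  shows "real (max_solution_free k c \<epsilon> p) \<le> b"
proof -
  have "max_solution_free k c \<epsilon> p \<in> insert 0 {card A | A. A \<subseteq> carrier (residue_ring (int p)) \<and> solution_free k c p A \<and>
     real (independence_number (cayley_digraph p A)) \<le> \<epsilon> * real p}"
    unfolding max_solution_free_def using finite_admissible_cards by (intro Max_in) auto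
  then show ?thesis unfolding carrier_residue_ring
  proof (elim insertE CollectE exE conjE)
    assume "max_solution_free k c \<epsilon> p = 0"
    then show ?thesis using assms(1) by simp
  next
    fix A assume "max_solution_free k c \<epsilon> p = card A" "A \<subseteq> {0..<int p}" "solution_free k c p A"
      "real (independence_number (cayley_digraph p A)) \<le> \<epsilon> * real p"
    then show ?thesis using assms(2) by metis
  qed
qed

lemma eventually_primes:
  "eventually P (inf at_top (principal {p::nat. prime p})) \<longleftrightarrow> (\<exists>N. \<forall>p\<ge>N. prime p \<longrightarrow> P p)"
  by (simp add: eventually_inf_principal eventually_at_top_linorder)

text \<open>An eventual lower bound passes to the \<open>Limsup\<close> only along a nontrivial
  filter; this is where the infinitude of the primes enters.\<close>

lemma primes_filter_nontrivial: "inf at_top (principal {p::nat. prime p}) \<noteq> bot"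
proof
  assume "inf at_top (principal {p::nat. prime p}) = bot"
  then have "eventually (\<lambda>_. False) (inf at_top (principal {p::nat. prime p}))" by simp
  then obtain N :: nat where "\<forall>p\<ge>N. \<not> prime p" unfolding eventually_primes by auto
  then show False using bigger_prime[of N] by (meson less_imp_le)
qed

text \<open>For fixed \<open>\<epsilon>\<close> every large prime exceeds the threshold of Roth's
  theorem for density \<open>\<epsilon>\<close>, divides no coefficient and satisfies
  \<open>1 \<le> \<epsilon> * p\<close>. The linear bound is at most \<open>sqrt \<epsilon>\<close>
  times \<open>p\<close>, because \<open>\<epsilon>\<close> is small compared with its
  constant.\<close>

lemma limsup_density_le:
  assumes k: "k \<ge> 3" and c: "\<And>i. i \<in> {1..k} \<Longrightarrow> c i \<noteq> 0" and c_sum: "(\<Sum>i=1..k. c i) \<noteq> 0"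
    and S: "S \<subseteq> {1..k}" "S \<noteq> {}" "sum c S = 0"
    and \<epsilon>: "\<epsilon> > 0" "\<epsilon> * (2 + k * (4 * real k + 3))\<^sup>2 \<le> 1"
  shows "limsup_density k c \<epsilon> \<le> ereal (\<epsilon> powr (1 / 2))"
proof -
  define K where "K = 1 + k * (4 * real k + 3)"
  have K: "K \<ge> 0" by (simp add: K_def)
  have finS: "finite S" using S finite_subset by blast
  have S_ne: "S \<noteq> {1..k}" using S(3) c_sum by auto
  have "\<exists>L0. \<forall>L\<ge>L0. \<forall>B\<subseteq>{0..<int L}. card S \<ge> 3 \<longrightarrow> solution_free_int S c B \<longrightarrow> real (card B) \<le> \<epsilon> * L"
  proof (cases "card S \<ge> 3")
    case True
    have "\<And>s. s \<in> S \<Longrightarrow> c s \<noteq> 0" using c S by blast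
    from Roth_translation_invariant[OF finS True this S(3) \<epsilon>(1)] show ?thesis by blast
  qed auto
  then obtain L0 where L0: "\<forall>L\<ge>L0. \<forall>B\<subseteq>{0..<int L}. card S \<ge> 3 \<longrightarrow> solution_free_int S c B \<longrightarrow> real (card B) \<le> \<epsilon> * L"
    by (elim exE)
  obtain N1 :: nat where N1: "N1 > 1 / \<epsilon>" using reals_Archimedean2 by blast
  define N2 where "N2 = nat (\<Sum>i=1..k. \<bar>c i\<bar>) + 1"
  have "real (max_solution_free k c \<epsilon> p) / p \<le> \<epsilon> powr (1 / 2)" if p: "p \<ge> L0 + N1 + N2" "prime p" for p
  proof -
    have p0: "real p > 0" using prime_gt_0_nat[OF p(2)] by simp
    have "1 / \<epsilon> \<le> p" using N1 p(1) by linarith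
    then have "1 \<le> \<epsilon> * p" using \<epsilon> by (simp add: field_simps)
    have c_p: "\<not> int p dvd c i" if i: "i \<in> {1..k}" for i
    proof
      assume "int p dvd c i"
      then have "int p \<le> \<bar>c i\<bar>" using dvd_imp_le_int[OF c[OF i], of "int p"] by simp
      also have "\<dots> \<le> (\<Sum>i=1..k. \<bar>c i\<bar>)" using i by (intro member_le_sum) auto
      finally show False using p(1) unfolding N2_def by linarith
    qed
    have "real (max_solution_free k c \<epsilon> p) \<le> 1 + K * (\<epsilon> * p)"
    proof (rule max_solution_free_le)
      show "0 \<le> 1 + K * (\<epsilon> * p)" using K \<epsilon> by simp
      fix A assume A: "A \<subseteq> {0..<int p}" "solution_free k c p A"
        "real (independence_number (cayley_digraph p A)) \<le> \<epsilon> * real p"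
      have "p \<ge> L0" using p(1) by simp
      with L0 have "\<And>B. card S \<ge> 3 \<Longrightarrow> B \<subseteq> {0..<int p} \<Longrightarrow> solution_free_int S c B \<Longrightarrow> real (card B) \<le> \<epsilon> * p"
        by blast
      from solution_free_card_le[OF p(2) A c_p S S_ne this \<epsilon>(1)]
      show "real (card A) \<le> 1 + K * (\<epsilon> * p)" by (simp add: K_def)
    qed
    also have "\<dots> \<le> (1 + K) * (\<epsilon> * p)" using \<open>1 \<le> \<epsilon> * p\<close> by (simp add: distrib_right)
    also have "\<dots> \<le> sqrt \<epsilon> * p"
    proof -
      have "sqrt (\<epsilon> * (1 + K)\<^sup>2) \<le> sqrt 1" using \<epsilon>(2) unfolding K_def by (intro real_sqrt_le_mono) (simp add: add.assoc[symmetric])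
      then have "sqrt \<epsilon> * (1 + K) \<le> 1" using K by (simp add: real_sqrt_mult)
      then have "sqrt \<epsilon> * (1 + K) * (sqrt \<epsilon> * p) \<le> 1 * (sqrt \<epsilon> * p)" using \<epsilon> by (intro mult_right_mono) auto
      also have "sqrt \<epsilon> * (1 + K) * (sqrt \<epsilon> * p) = (1 + K) * ((sqrt \<epsilon> * sqrt \<epsilon>) * p)" by (simp only: mult_ac)
      also have "sqrt \<epsilon> * sqrt \<epsilon> = \<epsilon>" using \<epsilon>(1) by simp
      finally show ?thesis by simp
    qed
    finally show ?thesis using p0 \<epsilon> by (simp add: powr_half_sqrt divide_le_eq)
  qed
  then show ?thesis unfolding limsup_density_def
    by (intro Limsup_bounded) (auto simp: eventually_primes intro!: exI[of _ "L0 + N1 + N2"])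
qed

lemma limsup_density_ge:
  assumes k: "k \<ge> 3" and c: "\<And>i. i \<in> {1..k} \<Longrightarrow> c i \<noteq> 0" and c_sum: "(\<Sum>i=1..k. c i) \<noteq> 0"
  shows "\<exists>C1>0. \<forall>\<epsilon>. 0 < \<epsilon> \<longrightarrow> \<epsilon> \<le> exp (- 1) \<longrightarrow> ereal (\<epsilon> powr C1) \<le> limsup_density k c \<epsilon>"
proof -
  define C where "C = (\<Sum>i=1..k. c i)"
  \<comment> \<open>Any \<open>q\<close> above \<open>\<bar>C\<bar>\<close> fails to divide the
    nonzero number \<open>C\<close>.\<close>
  define q where "q = nat \<bar>C\<bar> + 1"
  have q: "q \<ge> 2" "\<not> int q dvd C"
  proof -
    show "q \<ge> 2" using c_sum by (simp add: q_def C_def)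
    show "\<not> int q dvd C"
    proof
      assume "int q dvd C"
      then have "int q \<le> \<bar>C\<bar>" using dvd_imp_le_int[of C "int q"] c_sum by (simp add: C_def)
      then show False by (simp add: q_def)
    qed
  qed
  define B where "B = real_of_int (\<Sum>i=1..k. \<bar>c i\<bar>)"
  have "\<bar>c 1\<bar> \<le> (\<Sum>i=1..k. \<bar>c i\<bar>)" using k by (intro member_le_sum) auto
  moreover have "\<bar>c 1\<bar> \<ge> 1" using c[of 1] k by simp
  ultimately have B: "B \<ge> 1" unfolding B_def by linarith
  \<comment> \<open>Half of the largest deviation that excludes solutions; likewise
    \<open>\<tau>\<close> below is half of \<open>1 / k\<close>.\<close>
  define \<eta> where "\<eta> = 1 / (2 * q * B)"
  have \<eta>: "\<eta> > 0" "\<eta> * B < 1 / q" using B q(1) by (auto simp: \<eta>_def field_simps)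
  have "\<eta> * 1 \<le> \<eta> * B" using \<eta> B by (intro mult_left_mono) auto
  then have \<eta>q: "\<eta> < 1 / q" using \<eta> by linarith
  define \<tau> where "\<tau> = 1 / (2 * real k)"
  have \<tau>: "\<tau> > 0" "k * \<tau> < 1" "\<tau> < 1" using k by (auto simp: \<tau>_def field_simps)
  obtain m0 :: nat where m0: "m0 > 2 / \<eta>" using reals_Archimedean2 by blast
  define m where "m = m0 + 2"
  have m: "m > 0" "1 / m \<le> \<eta> / 2" "ln m > 0"
  proof -
    show "m > 0" "ln m > 0" by (auto simp: m_def)
    have "2 / \<eta> \<le> m" using m0 by (simp add: m_def)
    then show "1 / m \<le> \<eta> / 2" using \<eta> \<open>m > 0\<close> by (simp add: field_simps)
  qed
  \<comment> \<open>Concentration needs \<open>d\<close> about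
    \<open>4 / \<tau>\<^sup>2 * (- ln \<epsilon>)\<close>, and the density is at least
    \<open>1 / m ^ d\<close>. The summand \<open>1\<close> pays for rounding \<open>d\<close> up,
    since \<open>- ln \<epsilon> \<ge> 1\<close>.\<close>
  define C1 where "C1 = (4 / \<tau>\<^sup>2 + 1) * ln m"
  have "C1 > 0" unfolding C1_def using \<tau> m by (intro mult_pos_pos add_pos_pos) auto
  moreover have "ereal (\<epsilon> powr C1) \<le> limsup_density k c \<epsilon>" if \<epsilon>: "0 < \<epsilon>" "\<epsilon> \<le> exp (- 1)" for \<epsilon>
  proof -
    have "ln \<epsilon> \<le> ln (exp (- 1))" using \<epsilon> by (subst ln_le_cancel_iff) auto
    then have ln\<epsilon>: "- ln \<epsilon> \<ge> 1" by simp
    define d where "d = nat \<lceil>4 / \<tau>\<^sup>2 * (- ln \<epsilon>)\<rceil>"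
    have pos: "4 / \<tau>\<^sup>2 * (- ln \<epsilon>) > 0" using \<tau> ln\<epsilon> by (intro mult_pos_pos) auto
    then have d: "d > 0" "d \<ge> 4 / \<tau>\<^sup>2 * (- ln \<epsilon>)" "d \<le> 4 / \<tau>\<^sup>2 * (- ln \<epsilon>) + 1"
      unfolding d_def by linarith+
    have "- (\<tau>\<^sup>2 * d / 4) \<le> ln \<epsilon>" using d(2) \<tau> by (simp add: field_simps)
    then have "exp (- (\<tau>\<^sup>2 * d / 4)) \<le> exp (ln \<epsilon>)" by (subst exp_le_cancel_iff)
    then have exp_le: "exp (- (\<tau>\<^sup>2 * d / 4)) \<le> \<epsilon>" using \<epsilon> by simp
    have "\<epsilon> powr C1 = exp (C1 * ln \<epsilon>)" using \<epsilon> by (simp add: powr_def)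
    also have "\<dots> \<le> exp (- (real d * ln m))"
    proof -
      have "real d \<le> (4 / \<tau>\<^sup>2 + 1) * (- ln \<epsilon>)" using d(3) ln\<epsilon> by (simp add: algebra_simps)
      then have "real d * ln m \<le> (4 / \<tau>\<^sup>2 + 1) * (- ln \<epsilon>) * ln m" using m(3) by (intro mult_right_mono) auto
      then show ?thesis by (simp add: C1_def mult_ac)
    qed
    also have "\<dots> = 1 / real m ^ d" using m(1) by (simp add: exp_minus exp_of_nat_mult inverse_eq_divide)
    finally have powr_le: "\<epsilon> powr C1 \<le> 1 / real m ^ d" .
    obtain P0 where P0: "\<forall>p\<ge>P0. \<exists>r h. grid_system p q d (\<eta> / 2) r h"
      using grid_system_exists[OF q(1), of "\<eta> / 2" d] \<eta> by auto
    have "\<epsilon> powr C1 \<le> real (max_solution_free k c \<epsilon> p) / p" if p: "p \<ge> P0" "prime p" for p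
    proof -
      have p0: "p > 0" using prime_gt_0_nat[OF p(2)] .
      obtain r h where grid: "grid_system p q d (\<eta> / 2) r h" using P0 p by blast
      have grid': "grid_system p q d \<eta> r h" by (rule grid_system_mono[OF grid]) (use \<eta> in simp)
      define A where "A = torus_set p q d r \<eta> \<tau>"
      have "real p / real m ^ d \<le> card A"
        unfolding A_def by (rule card_torus_set_ge[OF p0 m(1,2) grid]) (use q \<tau> in auto)
      also have "card A \<le> max_solution_free k c \<epsilon> p"
      proof (rule card_le_max_solution_free)
        show "A \<subseteq> {0..<int p}" by (auto simp: A_def torus_set_def)
        show "solution_free k c p A" unfolding A_def
          by (rule solution_free_torus_set[OF p0 _ _ _ \<tau>(2) d(1)]) (use q \<eta> in \<open>auto simp: C_def B_def\<close>)
        show "real (independence_number (cayley_digraph p A)) \<le> \<epsilon> * real p" unfolding A_def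
          by (rule independence_number_torus_set_le[OF p0 q(1) _ \<eta>q grid' _ \<tau>(3) d(1) exp_le]) (use \<eta> \<tau> in auto)
      qed
      finally have "real p / real m ^ d / p \<le> real (max_solution_free k c \<epsilon> p) / p"
        by (intro divide_right_mono) auto
      then show ?thesis using powr_le p0 by simp
    qed
    then show ?thesis unfolding limsup_density_def
      by (intro le_Limsup primes_filter_nontrivial) (auto simp: eventually_primes intro!: exI[of _ P0])
  qed
  ultimately show ?thesis by blast
qed

theorem theorem1p4:
  fixes k :: nat and c :: "nat \<Rightarrow> int"
  assumes "k \<ge> 3"
    and "\<And>i. i \<in> {1..k} \<Longrightarrow> c i \<noteq> 0"
    and "(\<Sum>i=1..k. c i) \<noteq> 0"
    and "\<exists>S. S \<subseteq> {1..k} \<and> S \<noteq> {} \<and> (\<Sum>s\<in>S. c s) = 0"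
  shows "\<exists>C1 C2 :: real. C1 > 0 \<and> C2 > 0 \<and>
           (\<forall>\<^sub>F \<epsilon> in at_right 0.
              ereal (\<epsilon> powr C1) \<le> limsup_density k c \<epsilon> \<and>
              limsup_density k c \<epsilon> \<le> ereal (\<epsilon> powr C2))"
proof -
  obtain S where S: "S \<subseteq> {1..k}" "S \<noteq> {}" "sum c S = 0" using assms(4) by blast
  obtain C1 where C1: "C1 > 0"
    "\<And>\<epsilon>. 0 < \<epsilon> \<Longrightarrow> \<epsilon> \<le> exp (- 1) \<Longrightarrow> ereal (\<epsilon> powr C1) \<le> limsup_density k c \<epsilon>"
    using limsup_density_ge[OF assms(1-3)] by blast
  define K where "K = (2 + k * (4 * real k + 3))\<^sup>2"
  have K: "K > 0" unfolding K_def by (intro zero_less_power add_pos_nonneg) auto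
  define b where "b = min (exp (- 1)) (1 / K)"
  have "b > 0" using K by (simp add: b_def)
  moreover have "ereal (\<epsilon> powr C1) \<le> limsup_density k c \<epsilon> \<and> limsup_density k c \<epsilon> \<le> ereal (\<epsilon> powr (1 / 2))"
    if "0 < \<epsilon>" "\<epsilon> < b" for \<epsilon>
  proof
    have "\<epsilon> \<le> exp (- 1)" "\<epsilon> \<le> 1 / K" using that by (auto simp: b_def)
    then show "ereal (\<epsilon> powr C1) \<le> limsup_density k c \<epsilon>" using C1(2) that by blast
    have "\<epsilon> * K \<le> 1" using \<open>\<epsilon> \<le> 1 / K\<close> K by (simp add: field_simps)
    then show "limsup_density k c \<epsilon> \<le> ereal (\<epsilon> powr (1 / 2))"
      using limsup_density_le[OF assms(1-3) S \<open>0 < \<epsilon>\<close>] by (simp add: K_def)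
  qed
  ultimately have "\<forall>\<^sub>F \<epsilon> in at_right 0.
      ereal (\<epsilon> powr C1) \<le> limsup_density k c \<epsilon> \<and> limsup_density k c \<epsilon> \<le> ereal (\<epsilon> powr (1 / 2))"
    unfolding eventually_at_right_field by blast
  with C1(1) show ?thesis by (intro exI[of _ C1] exI[of _ "1 / 2"]) simp
qed

end
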